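(* Let $X$ be a factored chain complex over a field $\mathbb{F}$. Then $X$ is isomorphic to a finite direct sum of interval functors; more precisely, for every $n\in\mathbb{N}$ there exists a unique finite multiset $\mathrm{tBar}_n=\mathrm{tBar}_n(X)$ of tagged intervals (for $n=0$, only tagged intervals of the form $[0,0,t)$ are allowed) such that $$X \cong \bigoplus_{n\in\mathbb{N}}\ \bigoplus_{[0,s,t)\in \mathrm{tBar}_n} \mathcal{I}^n[0,s,t).$$
   Context: $\mathbb{N}=\{0,1,2,\dots\}$. Fix a field $\mathbb{F}$. $\mathrm{Ch}$ is the category of chain complexes of $\mathbb{F}$-vector spaces that are non-negative ($C_i=0$ for $i<0$) and compact (every $C_i$ is finite-dimensional and $C_i=0$ for all but finitely many $i$), with chain maps. A parametrized chain complex is a functor $X\colon[0,\infty)\to\mathrm{Ch}$, where $[0,\infty)$ is the poset category; its values are written $X^t$ and its internal maps $X^{s\le t}\colon X^s\to X^t$. Morphisms of parametrized chain complexes are natural transformations; direct sums are taken pointwise. $X$ is right-constant at $t$ if there is $\varepsilon>0$ such that $X^{t\le t+\delta}$ is an isomorphism for all $0\le\delta\le\varepsilon$; $X$ is left-constant at $t$ if $t=0$ or there is $\varepsilon>0$ such that $X^{t-\delta\le t}$ is an isomorphism for all $0\le\delta\le\varepsilon$. $X$ is tame if it is right-constant at every $t\in[0,\infty)$ and left-constant everywhere but on a finite set; $X$ is epimorphic if all internal maps are epimorphisms (surjective in every degree). A factored chain complex is a tame epimorphic parametrized chain complex. For $n\ge1$, the disk $D^n\in\mathrm{Ch}$ has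 $\mathbb{F}$ in degrees $n$ and $n-1$, zero elsewhere, and $\partial_n=\mathrm{id}_{\mathbb{F}}$. For $n\ge0$, the sphere $S^n$ has $\mathbb{F}$ in degree $n$ and zero elsewhere. $\Psi^n\colon D^n\to S^n$ is the chain map which is the identity in degree $n$ and zero in all other degrees. A tagged interval $[0,s,t)$ is a real interval $[0,t)$ with $0<t\le\infty$ together with a distinguished point $s\in[0,t]$. For $n\in\mathbb{N}$ and a tagged interval $[0,s,t)$ (with $s=0$ if $n=0$), the interval functor $\mathcal{I}^n[0,s,t)$ is the parametrized chain complex with $(\mathcal{I}^n[0,s,t))^r = D^n$ if $0\le r<s$, $S^n$ if $s\le r<t$, and $0$ otherwise; its internal map for $q\le r$ is $\mathrm{id}_{D^n}$ if $0\le q\le r<s$, $\Psi^n$ if $0\le q<s\le r<t$, $\mathrm{id}_{S^n}$ if $s\le q\le r<t$, and $0$ otherwise. A multiset is a set together with a positive multiplicity for each element; a direct sum over a multiset takes each element with its multiplicity. *)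

theory Defs
  imports
    "Jordan_Normal_Form.VS_Connect"
    "HOL-Library.Multiset"
    "HOL-Library.Extended_Real"
begin

section \<open>Chain complexes\<close>

text \<open>
  The ground field is a type \<open>'k\<close> of class \<^class>\<open>field\<close>; a vector space over it is a
  \<open>module\<close> record that satisfies \<open>vectorspace class_ring\<close>, with its own carrier and operations.

  Degrees are natural numbers, so complexes are non-negative by construction.
  The differential leaving degree \<open>n + 1\<close> is \<open>bdry C (Suc n)\<close>;
  the component \<open>bdry C 0\<close>, which would map to degree \<open>-1\<close>, plays no role. All maps are
  meaningful only on the carriers of their domains.
\<close>

record ('k, 'v) chain_complex =
  space_at :: "nat \<Rightarrow> ('k, 'v) module"
  bdry :: "nat \<Rightarrow> 'v \<Rightarrow> 'v"

definition is_Ch :: "('k::field, 'v) chain_complex \<Rightarrow> bool" where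
  "is_Ch C \<longleftrightarrow>
     (\<forall>n. vectorspace class_ring (space_at C n)) \<and>
     (\<forall>n. linear_map class_ring (space_at C (Suc n)) (space_at C n) (bdry C (Suc n))) \<and>
     (\<forall>n. \<forall>x\<in>carrier (space_at C (Suc (Suc n))).
        bdry C (Suc n) (bdry C (Suc (Suc n)) x) = \<zero>\<^bsub>space_at C n\<^esub>) \<and>
     (\<forall>n. vectorspace.fin_dim class_ring (space_at C n)) \<and>
     finite {n. carrier (space_at C n) \<noteq> {\<zero>\<^bsub>space_at C n\<^esub>}}"

definition chain_map ::
  "('k::field, 'v) chain_complex \<Rightarrow> ('k, 'w) chain_complex \<Rightarrow> (nat \<Rightarrow> 'v \<Rightarrow> 'w) \<Rightarrow> bool" where
  "chain_map C D f \<longleftrightarrow>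
     (\<forall>n. linear_map class_ring (space_at C n) (space_at D n) (f n)) \<and>
     (\<forall>n. \<forall>x\<in>carrier (space_at C (Suc n)).
        f n (bdry C (Suc n) x) = bdry D (Suc n) (f (Suc n) x))"

definition chain_iso ::
  "('k::field, 'v) chain_complex \<Rightarrow> ('k, 'w) chain_complex \<Rightarrow> (nat \<Rightarrow> 'v \<Rightarrow> 'w) \<Rightarrow> bool" where
  "chain_iso C D f \<longleftrightarrow> chain_map C D f \<and>
     (\<exists>g. chain_map D C g \<and>
        (\<forall>n. \<forall>x\<in>carrier (space_at C n). g n (f n x) = x) \<and>
        (\<forall>n. \<forall>y\<in>carrier (space_at D n). f n (g n y) = y))"

section \<open>Parametrized chain complexes\<close>

text \<open>
  The values at negative parameters, and the internal maps for parameters that do not satisfy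
  \<open>0 \<le> s \<le> t\<close>, are never used.
\<close>

record ('k, 'v) param_complex =
  val :: "real \<Rightarrow> ('k, 'v) chain_complex"
  trans_map :: "real \<Rightarrow> real \<Rightarrow> nat \<Rightarrow> 'v \<Rightarrow> 'v"

definition param_chain_complex :: "('k::field, 'v) param_complex \<Rightarrow> bool" where
  "param_chain_complex X \<longleftrightarrow>
     (\<forall>t\<ge>0. is_Ch (val X t)) \<and>
     (\<forall>s t. 0 \<le> s \<and> s \<le> t \<longrightarrow> chain_map (val X s) (val X t) (trans_map X s t)) \<and>
     (\<forall>t\<ge>0. \<forall>n. \<forall>x\<in>carrier (space_at (val X t) n). trans_map X t t n x = x) \<and>
     (\<forall>r s t. 0 \<le> r \<and> r \<le> s \<and> s \<le> t \<longrightarrow>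
        (\<forall>n. \<forall>x\<in>carrier (space_at (val X r) n).
           trans_map X s t n (trans_map X r s n x) = trans_map X r t n x))"

definition param_morphism ::
  "('k::field, 'v) param_complex \<Rightarrow> ('k, 'w) param_complex \<Rightarrow> (real \<Rightarrow> nat \<Rightarrow> 'v \<Rightarrow> 'w) \<Rightarrow> bool" where
  "param_morphism X Y f \<longleftrightarrow>
     (\<forall>t\<ge>0. chain_map (val X t) (val Y t) (f t)) \<and>
     (\<forall>s t. 0 \<le> s \<and> s \<le> t \<longrightarrow>
        (\<forall>n. \<forall>x\<in>carrier (space_at (val X s) n).
           f t n (trans_map X s t n x) = trans_map Y s t n (f s n x)))"

definition param_isomorphic ::
  "('k::field, 'v) param_complex \<Rightarrow> ('k, 'w) param_complex \<Rightarrow> bool"  (infix \<open>\<cong>\<^sub>p\<close> 50) where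
  "X \<cong>\<^sub>p Y \<longleftrightarrow>
     (\<exists>f g. param_morphism X Y f \<and> param_morphism Y X g \<and>
        (\<forall>t\<ge>0. \<forall>n. \<forall>x\<in>carrier (space_at (val X t) n). g t n (f t n x) = x) \<and>
        (\<forall>t\<ge>0. \<forall>n. \<forall>y\<in>carrier (space_at (val Y t) n). f t n (g t n y) = y))"

definition right_constant :: "('k::field, 'v) param_complex \<Rightarrow> real \<Rightarrow> bool" where
  "right_constant X t \<longleftrightarrow>
     (\<exists>\<epsilon>>0. \<forall>\<delta>. 0 \<le> \<delta> \<and> \<delta> \<le> \<epsilon> \<longrightarrow> chain_iso (val X t) (val X (t + \<delta>)) (trans_map X t (t + \<delta>)))"

text \<open>The bound \<open>\<epsilon> \<le> t\<close> keeps \<open>t - \<delta>\<close> inside the parameter poset.\<close>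

definition left_constant :: "('k::field, 'v) param_complex \<Rightarrow> real \<Rightarrow> bool" where
  "left_constant X t \<longleftrightarrow> t = 0 \<or>
     (\<exists>\<epsilon>>0. \<epsilon> \<le> t \<and>
        (\<forall>\<delta>. 0 \<le> \<delta> \<and> \<delta> \<le> \<epsilon> \<longrightarrow> chain_iso (val X (t - \<delta>)) (val X t) (trans_map X (t - \<delta>) t)))"

definition tame :: "('k::field, 'v) param_complex \<Rightarrow> bool" where
  "tame X \<longleftrightarrow> (\<forall>t\<ge>0. right_constant X t) \<and> finite {t. 0 \<le> t \<and> \<not> left_constant X t}"

definition epimorphic :: "('k::field, 'v) param_complex \<Rightarrow> bool" where
  "epimorphic X \<longleftrightarrow> (\<forall>s t. 0 \<le> s \<and> s \<le> t \<longrightarrow>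
     (\<forall>n. trans_map X s t n ` carrier (space_at (val X s) n) = carrier (space_at (val X t) n)))"

definition factored_chain_complex :: "('k::field, 'v) param_complex \<Rightarrow> bool" where
  "factored_chain_complex X \<longleftrightarrow> param_chain_complex X \<and> tame X \<and> epimorphic X"

section \<open>Interval functors\<close>

text \<open>The components \<open>mult\<close> and \<open>one\<close> of a \<open>module\<close> record are irrelevant for vector spaces.\<close>

definition field_space :: "('k::field, 'k) module" where
  "field_space = \<lparr>carrier = UNIV, mult = (*), one = 1, zero = 0, add = (+), smult = (*)\<rparr>"

definition zero_space :: "('k::field, 'k) module" where
  "zero_space = field_space\<lparr>carrier := {0}\<rparr>"

text \<open>
  The disk is used only for \<open>n \<ge> 1\<close>. Its differential is the identity out of degree \<open>n\<close> and zero
  out of every other degree.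
\<close>

definition disk :: "nat \<Rightarrow> ('k::field, 'k) chain_complex" where
  "disk n =
     \<lparr>space_at = (\<lambda>k. if k = n \<or> Suc k = n then field_space else zero_space),
      bdry = (\<lambda>k x. if k = n then x else 0)\<rparr>"

definition sphere :: "nat \<Rightarrow> ('k::field, 'k) chain_complex" where
  "sphere n =
     \<lparr>space_at = (\<lambda>k. if k = n then field_space else zero_space),
      bdry = (\<lambda>k x. 0)\<rparr>"

definition zero_complex :: "('k::field, 'k) chain_complex" where
  "zero_complex = \<lparr>space_at = (\<lambda>k. zero_space), bdry = (\<lambda>k x. 0)\<rparr>"

definition disk_to_sphere :: "nat \<Rightarrow> nat \<Rightarrow> 'k::field \<Rightarrow> 'k"  (\<open>\<Psi>\<close>) where
  "\<Psi> n k x = (if k = n then x else 0)"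

text \<open>
  The tagged interval \<open>[0,s,t)\<close> is the pair \<open>(s, t)\<close>. The tag \<open>s = \<infinity>\<close> is possible exactly when
  \<open>t = \<infinity>\<close>.
\<close>

type_synonym tagged_interval = "ereal \<times> ereal"

definition is_tagged_interval :: "tagged_interval \<Rightarrow> bool" where
  "is_tagged_interval I \<longleftrightarrow> (case I of (s, t) \<Rightarrow> 0 < t \<and> 0 \<le> s \<and> s \<le> t)"

definition interval_functor :: "nat \<Rightarrow> tagged_interval \<Rightarrow> ('k::field, 'k) param_complex" where
  "interval_functor n I = (case I of (s, t) \<Rightarrow>
     \<lparr>val = (\<lambda>r. if ereal r < s then disk n
                 else if ereal r < t then sphere n
                 else zero_complex),
      trans_map = (\<lambda>q r k x.
                 if ereal r < s then x
                 else if ereal q < s \<and> ereal r < t then \<Psi> n k x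
                 else if ereal r < t then x
                 else 0)\<rparr>)"

section \<open>Direct sums\<close>

definition direct_sum_space :: "'i set \<Rightarrow> ('i \<Rightarrow> ('k, 'v) module) \<Rightarrow> ('k, 'i \<Rightarrow> 'v) module" where
  "direct_sum_space I V =
     \<lparr>carrier = {f \<in> (\<Pi>\<^sub>E i\<in>I. carrier (V i)). finite {i\<in>I. f i \<noteq> \<zero>\<^bsub>V i\<^esub>}},
      mult = (\<lambda>f g. \<lambda>i\<in>I. f i \<otimes>\<^bsub>V i\<^esub> g i),
      one = (\<lambda>i\<in>I. \<one>\<^bsub>V i\<^esub>),
      zero = (\<lambda>i\<in>I. \<zero>\<^bsub>V i\<^esub>),
      add = (\<lambda>f g. \<lambda>i\<in>I. f i \<oplus>\<^bsub>V i\<^esub> g i),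
      smult = (\<lambda>c f. \<lambda>i\<in>I. c \<odot>\<^bsub>V i\<^esub> f i)\<rparr>"

definition direct_sum_complex ::
  "'i set \<Rightarrow> ('i \<Rightarrow> ('k, 'v) chain_complex) \<Rightarrow> ('k, 'i \<Rightarrow> 'v) chain_complex" where
  "direct_sum_complex I C =
     \<lparr>space_at = (\<lambda>n. direct_sum_space I (\<lambda>i. space_at (C i) n)),
      bdry = (\<lambda>n f. \<lambda>i\<in>I. bdry (C i) n (f i))\<rparr>"

definition direct_sum_param ::
  "'i set \<Rightarrow> ('i \<Rightarrow> ('k, 'v) param_complex) \<Rightarrow> ('k, 'i \<Rightarrow> 'v) param_complex" where
  "direct_sum_param I X =
     \<lparr>val = (\<lambda>t. direct_sum_complex I (\<lambda>i. val (X i) t)),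
      trans_map = (\<lambda>s t n f. \<lambda>i\<in>I. trans_map (X i) s t n (f i))\<rparr>"

text \<open>
  The summands of a direct sum over a multiset \<open>M\<close> are indexed by the pairs \<open>(a, j)\<close> with
  \<open>j < count M a\<close>, that is, by the elements of \<open>M\<close> together with a copy number.
\<close>

definition direct_sum_mset ::
  "'i multiset \<Rightarrow> ('i \<Rightarrow> ('k, 'v) param_complex) \<Rightarrow> ('k, 'i \<times> nat \<Rightarrow> 'v) param_complex" where
  "direct_sum_mset M X = direct_sum_param {(a, j). j < count M a} (\<lambda>(a, j). X a)"

definition is_tBar :: "('k::field, 'v) param_complex \<Rightarrow> (nat \<Rightarrow> tagged_interval multiset) \<Rightarrow> bool" where
  "is_tBar X B \<longleftrightarrow>
     (\<forall>n. \<forall>I\<in>#B n. is_tagged_interval I) \<and>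
     (\<forall>I\<in>#B 0. fst I = 0) \<and>
     X \<cong>\<^sub>p direct_sum_param UNIV (\<lambda>n. direct_sum_mset (B n) (interval_functor n))"

end

(* Since all internal maps are surjective, X is the quotient of the complex V = X^0 by the increasing
   family of subcomplexes K^t = ker (X^0 -> X^t), and tameness makes the death time
   d v = min {t. v : K^t} a well-defined ultrametric seminorm with finitely many values. The theorem
   amounts to a basis of V that is orthogonal for d and that splits into pairs x, Dx and cycles (D is the
   differential): a pair contributes the tagged interval [0, d(Dx), d x), a cycle z contributes [0, 0, d z).

   Such a basis comes from a greedy choice. In degree n one complements the cycles by repeatedly taking
   a vector outside the span so far which minimises d v and, among these, d(Dv); the chosen vectors are
   then orthogonal modulo cycles and their boundaries are orthogonal as well. Complementing the
   boundaries inside the cycles in the same way gives the unpaired cycles.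

   Conversely, any decomposition of X yields such a basis. Expanding one of them in another one only
   involves elements that die no later and whose boundaries die no later, so linear independence bounds
   the number of bars [0, s, t) with s <= a and t <= b in one decomposition by that in the other. *)
theory Submission
  imports Defs "HOL-Library.Function_Algebras"
begin

section \<open>Orthogonal complements\<close>

text \<open>Two filtrations of a finite-dimensional space have a common adapted basis, three in
  general do not. A degree of V carries more than two: the filtration by d, its pullback along D,
  the cycles and the boundaries. The construction works because the cycles are the bottom stage of
  the pullback, which is therefore constant on their cosets, and because inside the cycles only d
  and the boundaries remain. Hence the complements are taken modulo a subspace and in two stages.

  Bases and decompositions are linked by the predicate \<open>realizes\<close>, which phrases
  orthogonality as a description of the kernels of X^0 -> X^t; existence and uniqueness both go
  through it. For uniqueness, expanding a generator of degree n also produces boundaries from degree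
  n + 1, with no control on their bars. The counts therefore include all nonzero boundaries on both
  sides, and this number is cancelled afterwards.\<close>

lemma finite_range_minimizer:
  fixes f :: "'a \<Rightarrow> 'o::linorder"
  assumes "finite (range f)" and "A \<noteq> {}"
  obtains v where "v \<in> A" "\<And>w. w \<in> A \<Longrightarrow> f v \<le> f w"
proof -
  have fin: "finite (f ` A)" by (rule finite_subset[OF _ assms(1)]) auto
  then have "Min (f ` A) \<in> f ` A" using assms(2) by (intro Min_in) auto
  then obtain v where "v \<in> A" "Min (f ` A) = f v" by blast
  then show thesis using that[of v] Min_le[OF fin] by simp
qed

text \<open>Definitions made in \<open>vector_space\<close> itself would be hidden by their \<open>real_vector\<close> instances.\<close>

locale linear_space = vector_space scale
  for scale :: "'k::field \<Rightarrow> 'b::ab_group_add \<Rightarrow> 'b" (infixr \<open>*s\<close> 75)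
begin

text \<open>The values lie in an arbitrary linear order, so the least value \<open>N 0\<close>
  stands in for zero. For \<open>c \<noteq> 0\<close> the scaling inequality is an equality, by
  applying it to the inverse of \<open>c\<close>.\<close>

definition ultra_seminorm :: "('b \<Rightarrow> 'o::linorder) \<Rightarrow> bool" where
  "ultra_seminorm N \<longleftrightarrow> (\<forall>x y. N (x + y) \<le> max (N x) (N y)) \<and> (\<forall>c x. N (c *s x) \<le> N x)"

text \<open>Orthogonality in the non-Archimedean sense: no cancellation pushes a combination below
  one of the terms that occur in it. For finite \<open>S\<close> a bound on the remainder
  \<open>z\<close> follows, see \<open>ultra_seminorm_rest\<close>.\<close>

definition orthogonal_mod :: "('b \<Rightarrow> 'o::linorder) \<Rightarrow> 'b set \<Rightarrow> 'b set \<Rightarrow> bool" where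
  "orthogonal_mod N Z S \<longleftrightarrow>
     (\<forall>a. \<forall>z\<in>Z. \<forall>s\<in>S. a s \<noteq> 0 \<longrightarrow> N s \<le> N ((\<Sum>s\<in>S. a s *s s) + z))"

lemma orthogonal_modD:
  fixes S :: "'b set" and a :: "'b \<Rightarrow> 'k"
  assumes "orthogonal_mod N Z S" "z \<in> Z" "s \<in> S" "a s \<noteq> 0"
  shows "N s \<le> N ((\<Sum>s\<in>S. a s *s s) + z)"
  using assms unfolding orthogonal_mod_def by blast

lemma ultra_seminorm_add: "ultra_seminorm N \<Longrightarrow> N x \<le> c \<Longrightarrow> N y \<le> c \<Longrightarrow> N (x + y) \<le> c"
  unfolding ultra_seminorm_def by (meson max.boundedI order_trans)

lemma ultra_seminorm_scale: "ultra_seminorm N \<Longrightarrow> N (c *s x) \<le> N x"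
  unfolding ultra_seminorm_def by blast

lemma ultra_seminorm_zero: "ultra_seminorm N \<Longrightarrow> N 0 \<le> N x"
  using ultra_seminorm_scale[of N 0 x] by simp

lemma ultra_seminorm_diff:
  assumes "ultra_seminorm N" "N x \<le> c" "N y \<le> c" shows "N (x - y) \<le> c"
proof -
  have "N (- y) \<le> N y" using ultra_seminorm_scale[OF assms(1), of "-1" y] by simp
  then show ?thesis using ultra_seminorm_add[OF assms(1,2), of "- y"] assms(3) by simp
qed

lemma ultra_seminorm_sum:
  assumes N: "ultra_seminorm N" and "finite A" and c: "N 0 \<le> c"
    and "\<And>p. p \<in> A \<Longrightarrow> a p \<noteq> 0 \<Longrightarrow> N (f p) \<le> c"
  shows "N (\<Sum>p\<in>A. a p *s f p) \<le> c"
  using assms(2,4)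
proof (induction A rule: finite_induct)
  case empty
  then show ?case using c by simp
next
  case (insert q A)
  have "N (a q *s f q) \<le> c"
    using insert.prems[of q] c ultra_seminorm_scale[OF N, of "a q" "f q"]
    by (cases "a q = 0") auto
  then show ?case using insert ultra_seminorm_add[OF N] by simp
qed

text \<open>Here \<open>y\<close> is the whole minus the sum, and by assumption no term of the sum
  exceeds the whole.\<close>

lemma ultra_seminorm_rest:
  assumes N: "ultra_seminorm N" and "finite A"
    and "\<And>p. p \<in> A \<Longrightarrow> a p \<noteq> 0 \<Longrightarrow> N (f p) \<le> N ((\<Sum>p\<in>A. a p *s f p) + y)"
  shows "N y \<le> N ((\<Sum>p\<in>A. a p *s f p) + y)"
proof -
  let ?w = "(\<Sum>p\<in>A. a p *s f p) + y"
  have "N (?w - (\<Sum>p\<in>A. a p *s f p)) \<le> N ?w"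
    by (intro ultra_seminorm_diff[OF N] ultra_seminorm_sum[OF N assms(2)] ultra_seminorm_zero[OF N] order_refl assms(3))
  then show ?thesis by simp
qed

text \<open>The term of \<open>v\<close> is absorbed into the remainder, which then lies in the
  larger span. So \<open>orth\<close> bounds the terms of \<open>S\<close>,
  \<open>ultra_seminorm_rest\<close> bounds the remainder, and the remainder bounds
  \<open>v\<close>.\<close>

lemma orthogonal_mod_insert:
  assumes N: "ultra_seminorm N" and S: "finite S" "v \<notin> S"
    and orth: "orthogonal_mod N (span (insert v Q)) S"
    and v: "\<And>c z. c \<noteq> 0 \<Longrightarrow> z \<in> span Q \<Longrightarrow> N v \<le> N (c *s v + z)"
  shows "orthogonal_mod N (span Q) (insert v S)"
  unfolding orthogonal_mod_def
proof (intro allI ballI impI)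
  fix a :: "'b \<Rightarrow> 'k" and z s
  assume z: "z \<in> span Q" and s: "s \<in> insert v S" and a: "a s \<noteq> 0"
  define y where "y = a v *s v + z"
  have y: "y \<in> span (insert v Q)"
    unfolding y_def using z span_mono[of Q "insert v Q"] by (intro span_add span_scale[OF span_base]) auto
  have w: "(\<Sum>s\<in>insert v S. a s *s s) + z = (\<Sum>s\<in>S. a s *s s) + y"
    using S by (simp add: y_def algebra_simps)
  have *: "N s \<le> N ((\<Sum>s\<in>S. a s *s s) + y)" if "s \<in> S" "a s \<noteq> 0" for s
    using orthogonal_modD[OF orth y that(1), of a] that(2) by simp
  show "N s \<le> N ((\<Sum>s\<in>insert v S. a s *s s) + z)"
  proof (cases "s = v")
    case True
    then have "N v \<le> N y" using v[OF _ z, of "a v"] a by (simp add: y_def)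
    also have "\<dots> \<le> N ((\<Sum>s\<in>S. a s *s s) + y)"
      by (rule ultra_seminorm_rest[OF N S(1)]) (use * in auto)
    finally show ?thesis using True w by simp
  next
    case False
    then show ?thesis using * s a w by simp
  qed
qed

text \<open>The next vector of the complement minimises \<open>d\<close>, and then \<open>e\<close>, outside \<open>span Q\<close>. As \<open>e\<close> is only
  invariant under \<open>Z0\<close>, the last hypothesis is what survives the induction: modulo \<open>Z0\<close>, the elements of
  \<open>span Q\<close> can be represented by elements that do not increase \<open>d\<close>.\<close>

lemma simultaneous_orthogonal_complement:
  fixes d e :: "'b \<Rightarrow> 'o::linorder"
  assumes W: "subspace W" "W \<subseteq> span C" "finite C"
    and d: "ultra_seminorm d" "finite (range d)"
    and e: "ultra_seminorm e" "finite (range e)"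
    and Z0: "\<And>x z. z \<in> Z0 \<Longrightarrow> e (x + z) = e x"
    and Q: "independent Q" "Q \<subseteq> W"
    and inv: "\<And>z. z \<in> span Q \<Longrightarrow> \<exists>z'\<in>span Q. z - z' \<in> Z0 \<and> (\<forall>v\<in>W - span Q. d z' \<le> d v)"
  shows "\<exists>S. finite S \<and> S \<subseteq> W \<and> S \<inter> span Q = {} \<and> W \<subseteq> span (Q \<union> S) \<and>
     orthogonal_mod d (span Q) S \<and> orthogonal_mod e (span Q) S"
  using Q inv
proof (induction "card C - card Q" arbitrary: Q rule: less_induct)
  case less
  note Q = less.prems(1,2) and inv = less.prems(3)
  show ?case
  proof (cases "W \<subseteq> span Q")
    case True
    then show ?thesis by (intro exI[of _ "{}"]) (simp add: orthogonal_mod_def)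
  next
    case False
    define M where "M = {v \<in> W - span Q. \<forall>w\<in>W - span Q. d v \<le> d w}"
    have "W - span Q \<noteq> {}" using False by blast
    then obtain v0 where "v0 \<in> W - span Q" "\<And>w. w \<in> W - span Q \<Longrightarrow> d v0 \<le> d w"
      by (rule finite_range_minimizer[OF d(2)]) blast
    then have "M \<noteq> {}" unfolding M_def by blast
    then obtain v where vM: "v \<in> M" and ve: "\<And>w. w \<in> M \<Longrightarrow> e v \<le> e w"
      by (rule finite_range_minimizer[OF e(2)]) blast
    have vW: "v \<in> W" "v \<notin> span Q" and vd: "\<And>w. w \<in> W \<Longrightarrow> w \<notin> span Q \<Longrightarrow> d v \<le> d w"
      using vM by (auto simp: M_def)
    have sQ: "span Q \<subseteq> W" using Q(2) W(1) span_minimal by blast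
    let ?Q = "insert v Q"
    have ind: "independent ?Q" using Q vW independent_insertI by blast
    have QW: "?Q \<subseteq> W" using Q vW by blast
    \<comment> \<open>\<open>card C\<close> bounds every independent subset of \<open>W\<close>, so
      the induction measure drops with each new vector.\<close>
    have "finite ?Q \<and> card ?Q \<le> card C"
      by (rule independent_span_bound[OF W(3) ind order_trans[OF QW W(2)]])
    then have card: "card C - card ?Q < card C - card Q"
      using vW(2) span_base[of v Q] by (auto simp: card_insert_if)
    have notin: "c *s v + z \<notin> span Q" if "c \<noteq> 0" "z \<in> span Q" for c z
      
    proof
      assume "c *s v + z \<in> span Q"
      then have "c *s v \<in> span Q" using span_diff[OF _ that(2)] by fastforce
      then have "inverse c *s (c *s v) \<in> span Q" by (rule span_scale)
      then show False using that(1) vW(2) by simp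
    qed
    have inv': "\<exists>z'\<in>span ?Q. z - z' \<in> Z0 \<and> (\<forall>u\<in>W - span ?Q. d z' \<le> d u)" if zQ: "z \<in> span ?Q" for z
    proof -
      obtain c where c: "z - c *s v \<in> span Q" using zQ unfolding span_insert by blast
      \<comment> \<open>The multiple of \<open>v\<close> stays in the representative:
        \<open>v\<close> is \<open>d\<close>-minimal outside \<open>span Q\<close>, hence below
        everything outside the larger span.\<close>
      obtain z' where z': "z' \<in> span Q" "z - c *s v - z' \<in> Z0" "\<forall>v\<in>W - span Q. d z' \<le> d v"
        using inv[OF c] by blast
      have mono: "span Q \<subseteq> span ?Q" by (meson span_mono subset_insertI)
      have "z' + c *s v \<in> span ?Q" 
        using z'(1) mono by (intro span_add span_scale[OF span_base]) auto
      moreover have "z - (z' + c *s v) \<in> Z0" using z'(2) by (simp add: algebra_simps)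
      moreover have "d (z' + c *s v) \<le> d u" if "u \<in> W - span ?Q" for u
      proof (rule ultra_seminorm_add[OF d(1)])
        show "d z' \<le> d u" using z'(3) that mono by blast
        have "d v \<le> d u" using vd that mono by blast
        then show "d (c *s v) \<le> d u" using ultra_seminorm_scale[OF d(1)] order_trans by blast
      qed
      ultimately show ?thesis by blast
    qed
    obtain S where S: "finite S" "S \<subseteq> W" "S \<inter> span ?Q = {}" "W \<subseteq> span (?Q \<union> S)"
       and Sd: "orthogonal_mod d (span ?Q) S" and Se: "orthogonal_mod e (span ?Q) S"
      using less.hyps[OF card ind QW inv'] by blast
    have vS: "v \<notin> S" using S(3) span_base by blast
    have in_W: "c *s v + z \<in> W" if "z \<in> span Q" for c z
      using that vW(1) sQ W(1) by (auto intro!: subspace_add subspace_scale)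
    have "d v \<le> d (c *s v + z)" if "c \<noteq> 0" "z \<in> span Q" for c z
      using vd in_W notin that by blast
    then have 1: "orthogonal_mod d (span Q) (insert v S)"
      using orthogonal_mod_insert[OF d(1) S(1) vS Sd] by blast
    have "e v \<le> e (c *s v + z)" if c: "c \<noteq> 0" and z: "z \<in> span Q" for c z
    proof -
      \<comment> \<open>If \<open>d z\<close> is large, \<open>c *s v + z\<close> is not
        \<open>d\<close>-minimal and cannot be compared with \<open>v\<close> directly. Replacing
        \<open>z\<close> by \<open>z'\<close> keeps \<open>e\<close> and brings the vector into
        \<open>M\<close>.\<close>
      obtain z' where z': "z' \<in> span Q" "z - z' \<in> Z0" "\<forall>v\<in>W - span Q. d z' \<le> d v"
        using inv[OF z] by blast
      have "c *s v + z' \<in> W - span Q" using c z' in_W notin by blast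
      moreover have "d (c *s v + z') \<le> d v"
        using ultra_seminorm_add[OF d(1)] z'(3) vW ultra_seminorm_scale[OF d(1)] by blast
      ultimately have "c *s v + z' \<in> M" unfolding M_def using vd by fastforce
      then have "e v \<le> e (c *s v + z')" using ve by blast
      also have "\<dots> = e (c *s v + z' + (z - z'))" by (rule Z0[OF z'(2), symmetric])
      also have "c *s v + z' + (z - z') = c *s v + z" by simp
      finally show ?thesis .
    qed
    then have 2: "orthogonal_mod e (span Q) (insert v S)"
      using orthogonal_mod_insert[OF e(1) S(1) vS Se] by blast
    have "insert v S \<inter> span Q = {}"
      using S(3) vW(2) span_mono[of Q ?Q] by blast
    moreover have "W \<subseteq> span (Q \<union> insert v S)" using S(4) by simp
    ultimately show ?thesis using 1 2 S(1,2) vW(1) by (intro exI[of _ "insert v S"]) auto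
  qed
qed

text \<open>Starting the induction at a basis of \<open>Z\<close> makes its invariant trivial:
  \<open>e\<close> is invariant under all of \<open>Z\<close>, so 0 represents every
  element.\<close>

lemma orthogonal_complement:
  fixes d e :: "'b \<Rightarrow> 'o::linorder"
  assumes W: "subspace W" "W \<subseteq> span C" "finite C"
    and Z: "subspace Z" "Z \<subseteq> W"
    and d: "ultra_seminorm d" "finite (range d)"
    and e: "ultra_seminorm e" "finite (range e)" "\<And>x z. z \<in> Z \<Longrightarrow> e (x + z) = e x"
  shows "\<exists>S. finite S \<and> S \<subseteq> W \<and> S \<inter> Z = {} \<and>
    (\<forall>w\<in>W. \<exists>a. \<exists>z\<in>Z. w = (\<Sum>s\<in>S. a s *s s) + z) \<and>
    orthogonal_mod d Z S \<and> orthogonal_mod e Z S"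
proof -
  obtain Q where Q: "Q \<subseteq> Z" "independent Q" "Z \<subseteq> span Q"
    using maximal_independent_subset by blast
  have sQ: "span Q = Z" using Q Z(1) span_minimal by blast
  have inv: "\<exists>z'\<in>span Q. z - z' \<in> Z \<and> (\<forall>v\<in>W - span Q. d z' \<le> d v)" if "z \<in> span Q" for z
    using that sQ ultra_seminorm_zero[OF d(1)] by (intro bexI[of _ 0]) (auto simp: span_zero)
  obtain S where S: "finite S" "S \<subseteq> W" "S \<inter> Z = {}" "W \<subseteq> span (Q \<union> S)"
      "orthogonal_mod d Z S" "orthogonal_mod e Z S"
    using simultaneous_orthogonal_complement[OF W d e(1,2) e(3) Q(2) order_trans[OF Q(1) Z(2)] inv]
    unfolding sQ by blast
  have "\<exists>a. \<exists>z\<in>Z. w = (\<Sum>s\<in>S. a s *s s) + z" if "w \<in> W" for w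
  proof -
    have "w \<in> span (S \<union> Q)" using that S(4) by (auto simp: Un_commute)
    then obtain x z where xz: "w = x + z" "x \<in> span S" "z \<in> Z"
      unfolding span_Un sQ by blast
    then obtain a where "x = (\<Sum>s\<in>S. a s *s s)" using span_finite[OF S(1)] by auto
    then show ?thesis using xz by blast
  qed
  then show ?thesis using S by blast
qed

end

section \<open>Filtered complexes\<close>

text \<open>All degrees are subspaces \<open>U n\<close> of one ambient space on which
  \<open>D\<close> and \<open>d\<close> are total, so identities for sums carry no membership
  conditions.\<close>

locale filtered_complex = linear_space scale
  for scale :: "'k::field \<Rightarrow> 'b::ab_group_add \<Rightarrow> 'b" (infixr \<open>*s\<close> 75) +
  fixes U :: "nat \<Rightarrow> 'b set" and D :: "nat \<Rightarrow> 'b \<Rightarrow> 'b" and d :: "nat \<Rightarrow> 'b \<Rightarrow> ereal"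
  assumes U: "subspace (U n)" and fin: "\<exists>C. finite C \<and> U n \<subseteq> span C"
    and D_add: "D n (x + y) = D n x + D n y" and D_scale: "D n (c *s x) = c *s D n x"
    and D_in: "x \<in> U (Suc n) \<Longrightarrow> D (Suc n) x \<in> U n"
    and D_D: "x \<in> U (Suc (Suc n)) \<Longrightarrow> D (Suc n) (D (Suc (Suc n)) x) = 0"
    and D_0: "D 0 x = 0"
    and d: "ultra_seminorm (d n)" and d_range: "finite (range (d n))"
    and d_pos: "x \<in> U n \<Longrightarrow> d n x \<le> d n 0 \<Longrightarrow> x = 0"
begin

lemma D_zero: "D n 0 = 0"
  using D_scale[of n 0 0] by simp

lemma D_sum: "D n (\<Sum>p\<in>A. a p *s f p) = (\<Sum>p\<in>A. a p *s D n (f p))"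
  by (induction A rule: infinite_finite_induct) (auto simp: D_zero D_add D_scale)

definition cycles :: "nat \<Rightarrow> 'b set" where "cycles n = {x \<in> U n. D n x = 0}"

definition boundaries :: "nat \<Rightarrow> 'b set" where "boundaries n = D (Suc n) ` U (Suc n)"

lemma cycles_subspace: "subspace (cycles n)"
  using U[of n] unfolding cycles_def subspace_def by (auto simp: D_zero D_add D_scale)

lemma boundaries_subspace: "subspace (boundaries n)"
  unfolding subspace_def boundaries_def
proof safe
  have "D (Suc n) 0 \<in> D (Suc n) ` U (Suc n)" using U subspace_0 by blast
  then show "0 \<in> D (Suc n) ` U (Suc n)" by (simp add: D_zero)
next
  fix x y assume "x \<in> U (Suc n)" "y \<in> U (Suc n)"
  then show "D (Suc n) x + D (Suc n) y \<in> D (Suc n) ` U (Suc n)"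
    using U[of "Suc n"] subspace_add by (metis D_add imageI)
next
  fix c x assume "x \<in> U (Suc n)"
  then show "c *s D (Suc n) x \<in> D (Suc n) ` U (Suc n)"
    using U[of "Suc n"] subspace_scale by (metis D_scale imageI)
qed

lemma boundaries_subset_cycles: "boundaries n \<subseteq> cycles n"
  unfolding boundaries_def cycles_def using D_in D_D D_0 by (cases n) auto

text \<open>Adding a cycle leaves \<open>D n x\<close> unchanged, so the second seminorm is
  invariant modulo the cycles. In degree 0 the truncated \<open>n - 1\<close> is harmless:
  \<open>D 0\<close> vanishes and that seminorm is constant.\<close>

lemma complement_of_cycles:
  "\<exists>Y. finite Y \<and> Y \<subseteq> U n \<and> Y \<inter> cycles n = {} \<and>
     (\<forall>v\<in>U n. \<exists>a. \<exists>z\<in>cycles n. v = (\<Sum>y\<in>Y. a y *s y) + z) \<and>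
     orthogonal_mod (d n) (cycles n) Y \<and> orthogonal_mod (\<lambda>x. d (n - 1) (D n x)) (cycles n) Y"
proof -
  obtain C where C: "finite C" "U n \<subseteq> span C" using fin by blast
  have ZU: "cycles n \<subseteq> U n" unfolding cycles_def by blast
  have e: "ultra_seminorm (\<lambda>x. d (n - 1) (D n x))"
    using d[of "n - 1"] unfolding ultra_seminorm_def by (simp add: D_add D_scale)
  have e_range: "finite (range (\<lambda>x. d (n - 1) (D n x)))"
    by (rule finite_subset[OF _ d_range[of "n - 1"]]) auto
  have e_Z: "d (n - 1) (D n (x + z)) = d (n - 1) (D n x)" if "z \<in> cycles n" for x z
    using that by (simp add: D_add cycles_def)
  show ?thesis
    by (rule orthogonal_complement[OF U C(2,1) cycles_subspace ZU d d_range e e_range e_Z])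
qed

text \<open>All cycles have boundary 0, so a constant takes the place of the second
  seminorm.\<close>

lemma complement_of_boundaries:
  "\<exists>H. finite H \<and> H \<subseteq> cycles n \<and> H \<inter> boundaries n = {} \<and>
     (\<forall>v\<in>cycles n. \<exists>a. \<exists>z\<in>boundaries n. v = (\<Sum>h\<in>H. a h *s h) + z) \<and> orthogonal_mod (d n) (boundaries n) H"
proof -
  obtain C where C: "finite C" "U n \<subseteq> span C" using fin by blast
  have ZC: "cycles n \<subseteq> span C" using C unfolding cycles_def by blast
  have e: "ultra_seminorm (\<lambda>x::'b. 0::ereal)" by (simp add: ultra_seminorm_def)
  have e_range: "finite (range (\<lambda>x::'b. 0::ereal))" by simp
  show ?thesis
    using orthogonal_complement[OF cycles_subspace ZC C(1) boundaries_subspace boundaries_subset_cycles d[of n] d_range e e_range refl]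
    by (elim exE conjE) (intro exI conjI)
qed

text \<open>Generators of pairs and unpaired cycles share the set \<open>T n\<close>. An unpaired
  cycle in \<open>T (Suc n)\<close> has boundary 0, so it adds only a zero term to the second sum,
  and the last inequality is trivial for it.\<close>

lemma adapted_basis:
  obtains T where
    "\<And>n. finite (T n)" "\<And>n. T n \<subseteq> U n" "\<And>n. 0 \<notin> T n"
    "\<And>n v. v \<in> U n \<Longrightarrow>
       \<exists>a b. v = (\<Sum>x\<in>T n. a x *s x) + (\<Sum>x\<in>T (Suc n). b x *s D (Suc n) x)"
    "\<And>n a b x. x \<in> T n \<Longrightarrow> a x \<noteq> 0 \<Longrightarrow>
       d n x \<le> d n ((\<Sum>x\<in>T n. a x *s x) + (\<Sum>x\<in>T (Suc n). b x *s D (Suc n) x))"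
    "\<And>n a b x. x \<in> T (Suc n) \<Longrightarrow> b x \<noteq> 0 \<Longrightarrow>
       d n (D (Suc n) x) \<le> d n ((\<Sum>x\<in>T n. a x *s x) + (\<Sum>x\<in>T (Suc n). b x *s D (Suc n) x))"
proof -
  have "\<forall>n. \<exists>Y. finite Y \<and> Y \<subseteq> U n \<and> Y \<inter> cycles n = {} \<and>
     (\<forall>v\<in>U n. \<exists>a. \<exists>z\<in>cycles n. v = (\<Sum>y\<in>Y. a y *s y) + z) \<and>
     orthogonal_mod (d n) (cycles n) Y \<and> orthogonal_mod (\<lambda>x. d (n - 1) (D n x)) (cycles n) Y"
    by (intro allI complement_of_cycles)
  from choice[OF this] obtain Y where *: "\<forall>n. finite (Y n) \<and> Y n \<subseteq> U n \<and> Y n \<inter> cycles n = {} \<and>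
     (\<forall>v\<in>U n. \<exists>a. \<exists>z\<in>cycles n. v = (\<Sum>y\<in>Y n. a y *s y) + z) \<and>
     orthogonal_mod (d n) (cycles n) (Y n) \<and> orthogonal_mod (\<lambda>x. d (n - 1) (D n x)) (cycles n) (Y n)"
    by (elim exE)
  have Y: "\<And>n. finite (Y n)" "\<And>n. Y n \<subseteq> U n" "\<And>n. Y n \<inter> cycles n = {}"
    "\<And>n. \<forall>v\<in>U n. \<exists>a. \<exists>z\<in>cycles n. v = (\<Sum>y\<in>Y n. a y *s y) + z"
    "\<And>n. orthogonal_mod (d n) (cycles n) (Y n)"
    "\<And>n. orthogonal_mod (\<lambda>x. d (n - 1) (D n x)) (cycles n) (Y n)"
    using * by - (erule allE, elim conjE, assumption)+
  have "\<forall>n. \<exists>H. finite H \<and> H \<subseteq> cycles n \<and> H \<inter> boundaries n = {} \<and>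
     (\<forall>v\<in>cycles n. \<exists>a. \<exists>z\<in>boundaries n. v = (\<Sum>h\<in>H. a h *s h) + z) \<and> orthogonal_mod (d n) (boundaries n) H"
    by (intro allI complement_of_boundaries)
  from choice[OF this] obtain H where *: "\<forall>n. finite (H n) \<and> H n \<subseteq> cycles n \<and> H n \<inter> boundaries n = {} \<and>
     (\<forall>v\<in>cycles n. \<exists>a. \<exists>z\<in>boundaries n. v = (\<Sum>h\<in>H n. a h *s h) + z) \<and> orthogonal_mod (d n) (boundaries n) (H n)"
    by (elim exE)
  have H: "\<And>n. finite (H n)" "\<And>n. H n \<subseteq> cycles n" "\<And>n. H n \<inter> boundaries n = {}"
    "\<And>n. \<forall>v\<in>cycles n. \<exists>a. \<exists>z\<in>boundaries n. v = (\<Sum>h\<in>H n. a h *s h) + z"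
    "\<And>n. orthogonal_mod (d n) (boundaries n) (H n)"
    using * by - (erule allE, elim conjE, assumption)+
  define T where "T n = Y n \<union> H n" for n
  have disj: "Y n \<inter> H n = {}" for n using Y(3)[of n] H(2)[of n] by blast
  have sum_T: "(\<Sum>x\<in>T n. f x) = (\<Sum>x\<in>Y n. f x) + (\<Sum>x\<in>H n. f x)" for n and f :: "'b \<Rightarrow> 'b"
    unfolding T_def using Y(1) H(1) disj by (simp add: sum.union_disjoint)
  have DH: "D n h = 0" if "h \<in> H n" for n h using H(2) that by (auto simp: cycles_def)
  have sum_D: "(\<Sum>x\<in>T n. b x *s D n x) = D n (\<Sum>x\<in>Y n. b x *s x)" for n b
    unfolding sum_T D_sum by (simp add: DH)
  show thesis
  proof (rule that[of T])
    show "finite (T n)" for n unfolding T_def using Y(1) H(1) by simp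
    show "T n \<subseteq> U n" for n unfolding T_def using Y(2)[of n] H(2)[of n] by (auto simp: cycles_def)
    have "0 \<in> cycles n" "0 \<in> boundaries n" for n using cycles_subspace boundaries_subspace subspace_0 by blast+
    then show "0 \<notin> T n" for n unfolding T_def using Y(3) H(3) by blast
  next
    fix n v assume "v \<in> U n"
    then obtain a z where v: "v = (\<Sum>y\<in>Y n. a y *s y) + z" and z: "z \<in> cycles n" using Y(4) by blast
    obtain a' w where z: "z = (\<Sum>h\<in>H n. a' h *s h) + D (Suc n) w" and w: "w \<in> U (Suc n)"
      using bspec[OF H(4) z] unfolding boundaries_def by blast
    obtain b z' where w: "w = (\<Sum>y\<in>Y (Suc n). b y *s y) + z'" and z': "z' \<in> cycles (Suc n)"
      using bspec[OF Y(4) w] by blast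
    define c where "c x = (if x \<in> Y n then a x else a' x)" for x
    have "(\<Sum>x\<in>T n. c x *s x) = (\<Sum>y\<in>Y n. a y *s y) + (\<Sum>h\<in>H n. a' h *s h)"
      unfolding sum_T using disj by (intro arg_cong2[where f="(+)"] sum.cong) (auto simp: c_def)
    moreover have "D (Suc n) w = (\<Sum>x\<in>T (Suc n). b x *s D (Suc n) x)"
      using z' unfolding sum_D w by (simp add: D_add cycles_def)
    ultimately show "\<exists>a b. v = (\<Sum>x\<in>T n. a x *s x) + (\<Sum>x\<in>T (Suc n). b x *s D (Suc n) x)"
      unfolding v z by (intro exI[of _ c] exI[of _ b]) (simp add: add.assoc)
  next
    fix n a b
    \<comment> \<open>The combination has three layers: generators of pairs modulo cycles, unpaired
      cycles modulo boundaries, and the boundary \<open>\<beta>\<close>. In each of the first two,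
      orthogonality bounds the terms and passes the bound on to the remainder.\<close>
    define \<beta> where "\<beta> = (\<Sum>x\<in>T (Suc n). b x *s D (Suc n) x)"
    define z where "z = (\<Sum>h\<in>H n. a h *s h) + \<beta>"
    let ?w = "(\<Sum>x\<in>T n. a x *s x) + (\<Sum>x\<in>T (Suc n). b x *s D (Suc n) x)"
    have \<beta>D: "\<beta> = D (Suc n) (\<Sum>x\<in>Y (Suc n). b x *s x)" unfolding \<beta>_def by (rule sum_D)
    have "(\<Sum>x\<in>Y (Suc n). b x *s x) \<in> U (Suc n)"
      using Y(2) U by (intro subspace_sum subspace_scale) auto
    then have \<beta>: "\<beta> \<in> boundaries n" unfolding \<beta>D boundaries_def by blast
    have z: "z \<in> cycles n" unfolding z_def using \<beta> boundaries_subset_cycles H(2) cycles_subspace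
      by (intro subspace_add subspace_sum subspace_scale) auto
    have w: "?w = (\<Sum>y\<in>Y n. a y *s y) + z" unfolding z_def \<beta>_def sum_T by (simp add: add.assoc)
    have 1: "d n y \<le> d n ?w" if "y \<in> Y n" "a y \<noteq> 0" for y
      unfolding w by (rule orthogonal_modD[where a = a, OF Y(5) z that])
    have 2: "d n z \<le> d n ?w" using 1 unfolding w by (intro ultra_seminorm_rest[OF d Y(1)])
    have 3: "d n h \<le> d n z" if "h \<in> H n" "a h \<noteq> 0" for h
      unfolding z_def by (rule orthogonal_modD[where a = a, OF H(5) \<beta> that])
    have 4: "d n \<beta> \<le> d n z" using 3 unfolding z_def by (intro ultra_seminorm_rest[OF d H(1)])
    show "d n x \<le> d n ?w" if "x \<in> T n" "a x \<noteq> 0" for x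
    proof (cases "x \<in> Y n")
      case True
      then show ?thesis using 1 that(2) by simp
    next
      case False
      then have "d n x \<le> d n z" using 3[OF _ that(2)] that(1) unfolding T_def by blast
      then show ?thesis using 2 by simp
    qed
    show "d n (D (Suc n) x) \<le> d n ?w" if x: "x \<in> T (Suc n)" "b x \<noteq> 0" for x
    proof (cases "x \<in> Y (Suc n)")
      case True
      \<comment> \<open>With remainder 0, orthogonality for the pullback of \<open>d\<close> one
        degree higher is orthogonality of the boundaries.\<close>
      have "0 \<in> cycles (Suc n)" using cycles_subspace subspace_0 by blast
      from orthogonal_modD[where a = b, OF Y(6) this True x(2)] have "d n (D (Suc n) x) \<le> d n \<beta>"
        unfolding \<beta>D by simp
      then show ?thesis using 2 4 by simp
    next
      case False
      then have "D (Suc n) x = 0" using x(1) DH unfolding T_def by blast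
      then show ?thesis using ultra_seminorm_zero[OF d] by simp
    qed
  qed
qed

end

section \<open>Multisets and their copies\<close>

text \<open>The index set of \<open>direct_sum_mset\<close>: \<open>fst p\<close> is the element and
  \<open>snd p\<close> its copy number.\<close>

definition copies :: "'i multiset \<Rightarrow> ('i \<times> nat) set" where
  "copies M = {(a, j). j < count M a}"

lemma finite_copies: "finite (copies M)"
proof -
  have "copies M = (SIGMA a:set_mset M. {..<count M a})"
    unfolding copies_def by (auto simp: not_in_iff[symmetric]) (metis count_eq_zero_iff not_less_zero)
  then show ?thesis by simp
qed

lemma fst_copies: "p \<in> copies M \<Longrightarrow> fst p \<in># M"
  unfolding copies_def by (auto simp: count_greater_zero_iff[symmetric] simp del: count_greater_zero_iff)

lemma card_copies_filter:
  "card {p \<in> copies M. P (fst p)} = size (filter_mset P M)"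
proof -
  have "{p \<in> copies M. P (fst p)} = (SIGMA a:set_mset (filter_mset P M). {..<count M a})"
    unfolding copies_def by (auto simp: count_greater_zero_iff[symmetric] simp del: count_greater_zero_iff)
  then have "card {p \<in> copies M. P (fst p)} = (\<Sum>a\<in>set_mset (filter_mset P M). count M a)"
    by (simp add: card_SigmaI)
  also have "\<dots> = (\<Sum>a\<in>set_mset (filter_mset P M). count (filter_mset P M) a)"
    by (intro sum.cong) auto
  finally show ?thesis by (simp add: size_multiset_overloaded_eq)
qed

text \<open>Numbering the fibres of \<open>h\<close> turns a basis with labelled vectors into a
  family indexed by the copies of the multiset of labels.\<close>

lemma copies_image_mset_bij:
  assumes "finite T"
  obtains \<pi> where "bij_betw \<pi> (copies (image_mset h (mset_set T))) T"
    "\<And>p. p \<in> copies (image_mset h (mset_set T)) \<Longrightarrow> h (\<pi> p) = fst p"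
proof -
  let ?M = "image_mset h (mset_set T)"
  have count: "count ?M a = card {x \<in> T. h x = a}" for a
    using assms by (simp add: count_image_mset_eq_card_vimage)
  have "\<exists>g. bij_betw g {..<count ?M a} {x \<in> T. h x = a}" for a
    unfolding count using ex_bij_betw_nat_finite[of "{x \<in> T. h x = a}"] assms
    by (auto simp: atLeast0LessThan)
  then obtain g where g: "\<And>a. bij_betw (g a) {..<count ?M a} {x \<in> T. h x = a}" by metis
  define \<pi> where "\<pi> = (\<lambda>(a, j). g a j)"
  have mem: "g a j \<in> T \<and> h (g a j) = a" if "j < count ?M a" for a j
    using bij_betw_apply[OF g[of a], of j] that by simp
  have "bij_betw \<pi> (copies ?M) T"
    unfolding bij_betw_def
  proof
    show "inj_on \<pi> (copies ?M)"
    proof (rule inj_onI)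
      fix p q assume p: "p \<in> copies ?M" and q: "q \<in> copies ?M" and eq: "\<pi> p = \<pi> q"
      obtain a i b j where ab: "p = (a, i)" "q = (b, j)" by (metis surj_pair)
      have "i < count ?M a" "j < count ?M b" using p q unfolding copies_def ab by auto
      moreover from this have "a = b" using mem eq unfolding \<pi>_def ab by (metis case_prod_conv)
      ultimately show "p = q"
        using eq bij_betw_imp_inj_on[OF g[of a]] unfolding ab \<pi>_def by (auto simp: inj_on_def)
    qed
    show "\<pi> ` copies ?M = T"
    proof
      show "\<pi> ` copies ?M \<subseteq> T" using mem unfolding \<pi>_def copies_def by auto
      show "T \<subseteq> \<pi> ` copies ?M"
      proof
        fix x assume "x \<in> T"
        then have "x \<in> g (h x) ` {..<count ?M (h x)}"
          using bij_betw_imp_surj_on[OF g[of "h x"]] by blast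
        then obtain j where "j < count ?M (h x)" "x = g (h x) j" by auto
        then show "x \<in> \<pi> ` copies ?M" unfolding \<pi>_def copies_def by (intro image_eqI[of _ _ "(h x, j)"]) auto
      qed
    qed
  qed
  moreover have "h (\<pi> p) = fst p" if "p \<in> copies ?M" for p
    using that mem unfolding \<pi>_def copies_def by auto
  ultimately show thesis by (rule that)
qed

text \<open>Induction over the componentwise order: once the multiplicities agree strictly below
  \<open>q\<close>, equality of the sizes at \<open>q\<close> leaves equality of the multiplicities
  of \<open>q\<close>.\<close>

lemma multiset_eq_if_lower_sizes_eq:
  fixes M N :: "('a::order \<times> 'b::order) multiset"
  assumes "\<And>s t. (s, t) \<in># M + N \<Longrightarrow>
    size {#p \<in># M. fst p \<le> s \<and> snd p \<le> t#} = size {#p \<in># N. fst p \<le> s \<and> snd p \<le> t#}"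
  shows "M = N"
proof (rule multiset_eqI)
  define S where "S = set_mset (M + N)"
  define below where "below q = {p \<in> S. fst p \<le> fst q \<and> snd p \<le> snd q}" for q
  fix q
  show "count M q = count N q"
  proof (cases "q \<in> S")
    case False
    then show ?thesis by (simp add: S_def not_in_iff)
  next
    case True
    then show ?thesis
    proof (induction "card (below q)" arbitrary: q rule: less_induct)
      case less
      have fin: "finite (below q)" unfolding below_def S_def by simp
      have size_eq: "size {#p \<in># K. fst p \<le> fst q \<and> snd p \<le> snd q#} = (\<Sum>p\<in>below q. count K p)"
        if "set_mset K \<subseteq> S" for K
      proof -
        have "size {#p \<in># K. fst p \<le> fst q \<and> snd p \<le> snd q#} =
            (\<Sum>p\<in>below q. count {#p \<in># K. fst p \<le> fst q \<and> snd p \<le> snd q#} p)"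
          unfolding size_multiset_overloaded_eq
          by (rule sum.mono_neutral_left) (use that fin in \<open>auto simp: below_def not_in_iff\<close>)
        also have "\<dots> = (\<Sum>p\<in>below q. count K p)" by (intro sum.cong) (auto simp: below_def)
        finally show ?thesis .
      qed
      have "(\<Sum>p\<in>below q. count M p) = (\<Sum>p\<in>below q. count N p)"
        using assms[of "fst q" "snd q"] less.prems size_eq[of M] size_eq[of N] unfolding S_def by simp
      moreover have q: "q \<in> below q" using less.prems unfolding below_def by simp
      moreover have "(\<Sum>p\<in>below q - {q}. count M p) = (\<Sum>p\<in>below q - {q}. count N p)"
      proof (rule sum.cong)
        fix p assume p: "p \<in> below q - {q}"
        then have "below p \<subseteq> below q" unfolding below_def by (auto intro: order_trans)
        moreover have "q \<notin> below p" using p unfolding below_def by (auto simp: prod_eq_iff)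
        ultimately have "below p \<subset> below q" using q by blast
        then have "card (below p) < card (below q)" using fin psubset_card_mono by blast
        then show "count M p = count N p" using less.hyps p unfolding below_def by blast
      qed simp
      ultimately show ?case using fin by (simp add: sum.remove[of _ q])
    qed
  qed
qed

section \<open>Linear maps and coordinates\<close>

abbreviation vs :: "('k::field, 'v) module \<Rightarrow> bool" where
  "vs V \<equiv> vectorspace class_ring V"

lemma linear_map_facts:
  assumes "linear_map (class_ring :: 'k::field ring) V W f"
  shows linear_map_closed: "x \<in> carrier V \<Longrightarrow> f x \<in> carrier W"
    and linear_map_add: "x \<in> carrier V \<Longrightarrow> y \<in> carrier V \<Longrightarrow> f (x \<oplus>\<^bsub>V\<^esub> y) = f x \<oplus>\<^bsub>W\<^esub> f y"
    and linear_map_smult: "x \<in> carrier V \<Longrightarrow> f (c \<odot>\<^bsub>V\<^esub> x) = c \<odot>\<^bsub>W\<^esub> f x"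
    and linear_map_zero: "f \<zero>\<^bsub>V\<^esub> = \<zero>\<^bsub>W\<^esub>"
proof -
  interpret linear_map class_ring V W f by fact
  show "x \<in> carrier V \<Longrightarrow> f x \<in> carrier W" by simp
  show "x \<in> carrier V \<Longrightarrow> y \<in> carrier V \<Longrightarrow> f (x \<oplus>\<^bsub>V\<^esub> y) = f x \<oplus>\<^bsub>W\<^esub> f y" by simp
  show "x \<in> carrier V \<Longrightarrow> f (c \<odot>\<^bsub>V\<^esub> x) = c \<odot>\<^bsub>W\<^esub> f x" by simp
  show "f \<zero>\<^bsub>V\<^esub> = \<zero>\<^bsub>W\<^esub>" by simp
qed

lemma vs_facts:
  assumes "vs (V :: ('k::field, 'v) module)"
  shows vs_add_closed: "x \<in> carrier V \<Longrightarrow> y \<in> carrier V \<Longrightarrow> x \<oplus>\<^bsub>V\<^esub> y \<in> carrier V"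
    and vs_smult_closed: "x \<in> carrier V \<Longrightarrow> c \<odot>\<^bsub>V\<^esub> x \<in> carrier V"
    and vs_add_zero: "\<zero>\<^bsub>V\<^esub> \<oplus>\<^bsub>V\<^esub> \<zero>\<^bsub>V\<^esub> = \<zero>\<^bsub>V\<^esub>"
    and vs_zero_smult: "x \<in> carrier V \<Longrightarrow> 0 \<odot>\<^bsub>V\<^esub> x = \<zero>\<^bsub>V\<^esub>"
    and vs_smult_zero: "c \<odot>\<^bsub>V\<^esub> \<zero>\<^bsub>V\<^esub> = \<zero>\<^bsub>V\<^esub>"
proof -
  interpret V: vectorspace class_ring V by fact
  show "\<zero>\<^bsub>V\<^esub> \<oplus>\<^bsub>V\<^esub> \<zero>\<^bsub>V\<^esub> = \<zero>\<^bsub>V\<^esub>" by simp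
  show "x \<in> carrier V \<Longrightarrow> y \<in> carrier V \<Longrightarrow> x \<oplus>\<^bsub>V\<^esub> y \<in> carrier V" by simp
  show "x \<in> carrier V \<Longrightarrow> c \<odot>\<^bsub>V\<^esub> x \<in> carrier V" by simp
  show "x \<in> carrier V \<Longrightarrow> 0 \<odot>\<^bsub>V\<^esub> x = \<zero>\<^bsub>V\<^esub>" using V.lmult_0[of x] by simp
  show "c \<odot>\<^bsub>V\<^esub> \<zero>\<^bsub>V\<^esub> = \<zero>\<^bsub>V\<^esub>" using V.rmult_0[of c] by simp
qed

lemma linear_mapI:
  assumes "vs (V :: ('k::field, 'v) module)" "vs (W :: ('k, 'w) module)"
    "\<And>x. x \<in> carrier V \<Longrightarrow> f x \<in> carrier W"
    "\<And>x y. x \<in> carrier V \<Longrightarrow> y \<in> carrier V \<Longrightarrow> f (x \<oplus>\<^bsub>V\<^esub> y) = f x \<oplus>\<^bsub>W\<^esub> f y"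
    "\<And>c x. x \<in> carrier V \<Longrightarrow> f (c \<odot>\<^bsub>V\<^esub> x) = c \<odot>\<^bsub>W\<^esub> f x"
  shows "linear_map class_ring V W f"
proof -
  interpret V: vectorspace class_ring V by fact
  interpret W: vectorspace class_ring W by fact
  have "f \<in> LinearCombinations.module_hom class_ring V W"
    by (simp add: LinearCombinations.module_hom_def Pi_iff assms(3-5))
  then show ?thesis by unfold_locales
qed

lemma linear_map_inj_on:
  assumes f: "linear_map (class_ring :: 'k::field ring) V W f"
    and ker: "\<And>x. x \<in> carrier V \<Longrightarrow> f x = \<zero>\<^bsub>W\<^esub> \<Longrightarrow> x = \<zero>\<^bsub>V\<^esub>"
  shows "inj_on f (carrier V)"
proof (rule inj_onI)
  interpret VV: vectorspace class_ring V using f by (simp add: linear_map_def)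
  interpret linear_map class_ring V W f by fact
  fix x y assume xy: "x \<in> carrier V" "y \<in> carrier V" "f x = f y"
  then have "f (x \<ominus>\<^bsub>V\<^esub> y) = \<zero>\<^bsub>W\<^esub>" by simp
  then have "x \<ominus>\<^bsub>V\<^esub> y = \<zero>\<^bsub>V\<^esub>" using xy ker by simp
  moreover have "x = (x \<ominus>\<^bsub>V\<^esub> y) \<oplus>\<^bsub>V\<^esub> y" using xy by (simp add: a_minus_def VV.a_assoc VV.l_neg)
  ultimately show "x = y" using xy by simp
qed

definition fun_scale :: "'k::field \<Rightarrow> ('v \<Rightarrow> 'k) \<Rightarrow> 'v \<Rightarrow> 'k" where
  "fun_scale c f = (\<lambda>x. c * f x)"

global_interpretation fs: linear_space fun_scale
  by unfold_locales (auto simp: fun_scale_def fun_eq_iff algebra_simps)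

text \<open>Coordinate vectors with respect to a basis \<open>\<beta>\<close>. They live in the
  space of all functions, where the operations are total; the support condition makes them a
  finite-dimensional subspace when \<open>\<beta>\<close> is finite.\<close>

definition supported_on :: "'v set \<Rightarrow> ('v \<Rightarrow> 'k::field) set" where
  "supported_on \<beta> = {f. \<forall>x. x \<notin> \<beta> \<longrightarrow> f x = 0}"

lemma supported_on_subspace: "fs.subspace (supported_on \<beta>)"
  unfolding fs.subspace_def supported_on_def by (auto simp: fun_scale_def)

lemma supported_on_span:
  assumes "finite \<beta>"
  shows "\<exists>C. finite C \<and> supported_on \<beta> \<subseteq> fs.span (C :: ('v \<Rightarrow> 'k::field) set)"
proof -
  define \<delta> :: "'v \<Rightarrow> 'v \<Rightarrow> 'k" where "\<delta> b = (\<lambda>x. if x = b then 1 else 0)" for b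
  have "f \<in> fs.span (\<delta> ` \<beta>)" if "f \<in> supported_on \<beta>" for f
  proof -
    have "f = (\<Sum>b\<in>\<beta>. fun_scale (f b) (\<delta> b))"
    proof
      fix x
      have "(\<Sum>b\<in>\<beta>. fun_scale (f b) (\<delta> b)) x = (\<Sum>b\<in>\<beta>. fun_scale (f b) (\<delta> b) x)"
        by (induction \<beta> rule: infinite_finite_induct) auto
      also have "\<dots> = (\<Sum>b\<in>\<beta>. if x = b then f b else 0)"
        by (intro sum.cong) (auto simp: fun_scale_def \<delta>_def)
      also have "\<dots> = f x" using assms that by (auto simp: supported_on_def)
      finally show "f x = (\<Sum>b\<in>\<beta>. fun_scale (f b) (\<delta> b)) x" by simp
    qed
    also have "\<dots> \<in> fs.span (\<delta> ` \<beta>)"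
      by (intro fs.span_sum fs.span_scale fs.span_base) auto
    finally show ?thesis .
  qed
  then show ?thesis using assms by (intro exI[of _ "\<delta> ` \<beta>"]) auto
qed

text \<open>\<open>E f\<close> is the linear combination of a basis \<open>\<beta>\<close> with
  coefficients \<open>f\<close>. It ignores \<open>f\<close> outside \<open>\<beta>\<close>, so it
  is linear on all functions, while bijectivity concerns those supported on
  \<open>\<beta>\<close>.\<close>

lemma coordinates_exist:
  fixes V :: "('k::field, 'v) module"
  assumes "vs V" "vectorspace.fin_dim class_ring V"
  shows "\<exists>(\<beta> :: 'v set) E. finite \<beta> \<and> (\<forall>f. E f \<in> carrier V) \<and>
     (\<forall>f g. E (f + g) = E f \<oplus>\<^bsub>V\<^esub> E g) \<and> (\<forall>c f. E (fun_scale c f) = c \<odot>\<^bsub>V\<^esub> E f) \<and>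
     bij_betw E (supported_on \<beta>) (carrier V)"
proof -
  interpret V: vectorspace class_ring V by fact
  obtain \<beta> where \<beta>: "finite \<beta>" "V.basis \<beta>" using V.finite_basis_exists assms(2) by blast
  have \<beta>V: "\<beta> \<subseteq> carrier V" using \<beta>(2) unfolding V.basis_def by blast
  define E where "E f = V.lincomb f \<beta>" for f
  have unique: "\<exists>!a. a \<in> \<beta> \<rightarrow>\<^sub>E UNIV \<and> V.lincomb a \<beta> = v" if "v \<in> carrier V" for v
    using V.basis_criterion[OF \<beta>(1) \<beta>V] \<beta>(2) that by auto
  have E_cong: "E f = E g" if "\<And>x. x \<in> \<beta> \<Longrightarrow> f x = g x" for f g
    unfolding E_def using that \<beta>V by (intro V.lincomb_cong) auto
  have closed: "E f \<in> carrier V" for f unfolding E_def using \<beta>V by (intro V.lincomb_closed) auto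
  have add: "E (f + g) = E f \<oplus>\<^bsub>V\<^esub> E g" for f g
    using V.lincomb_sum[OF \<beta>(1) \<beta>V, of f g] unfolding E_def by (simp add: plus_fun_def)
  have scale: "E (fun_scale c f) = c \<odot>\<^bsub>V\<^esub> E f" for c f
    using V.lincomb_smult[OF \<beta>V, of f c] unfolding E_def by (simp add: fun_scale_def)
  have "inj_on E (supported_on \<beta>)"
  proof (rule inj_onI)
    fix f g assume f: "f \<in> supported_on \<beta>" and g: "g \<in> supported_on \<beta>" and eq: "E f = E g"
    have "E (restrict h \<beta>) = E h" for h by (rule E_cong) simp
    then have "restrict f \<beta> \<in> \<beta> \<rightarrow>\<^sub>E UNIV \<and> V.lincomb (restrict f \<beta>) \<beta> = E f"
      "restrict g \<beta> \<in> \<beta> \<rightarrow>\<^sub>E UNIV \<and> V.lincomb (restrict g \<beta>) \<beta> = E f"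
      using eq unfolding E_def by auto
    then have "restrict f \<beta> = restrict g \<beta>"
      by - (rule alt_ex1E[OF unique[OF closed, of f]], iprover)
    then have *: "f x = g x" if "x \<in> \<beta>" for x using that by (metis restrict_apply')
    show "f = g"
    proof
      fix x show "f x = g x" using f g * unfolding supported_on_def by (cases "x \<in> \<beta>") auto
    qed
  qed
  moreover have "E ` supported_on \<beta> = carrier V"
  proof
    show "E ` supported_on \<beta> \<subseteq> carrier V" using closed by blast
    show "carrier V \<subseteq> E ` supported_on \<beta>"
    proof
      fix v assume "v \<in> carrier V"
      then obtain a where "E a = v" using ex1_implies_ex[OF unique] unfolding E_def by fast
      moreover have "E a = E (\<lambda>x. if x \<in> \<beta> then a x else 0)" by (rule E_cong) simp
      moreover have "(\<lambda>x. if x \<in> \<beta> then a x else 0) \<in> supported_on \<beta>"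
        by (simp add: supported_on_def)
      ultimately show "v \<in> E ` supported_on \<beta>" by blast
    qed
  qed
  ultimately show ?thesis using \<beta>(1) closed add scale
    by (intro exI[of _ \<beta>] exI[of _ E] conjI allI) (auto simp: bij_betw_def)
qed

lemma chain_mapD:
  assumes "chain_map C D f"
  shows "linear_map class_ring (space_at C n) (space_at D n) (f n)"
    and "x \<in> carrier (space_at C (Suc n)) \<Longrightarrow> f n (bdry C (Suc n) x) = bdry D (Suc n) (f (Suc n) x)"
  using assms unfolding chain_map_def by auto

lemma chain_iso_inj:
  assumes "chain_iso C D f" "x \<in> carrier (space_at C n)" "f n x = \<zero>\<^bsub>space_at D n\<^esub>"
  shows "x = \<zero>\<^bsub>space_at C n\<^esub>"
proof -
  obtain g where g: "chain_map D C g" "\<forall>n. \<forall>x\<in>carrier (space_at C n). g n (f n x) = x"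
    using assms(1) unfolding chain_iso_def by auto
  have "x = g n (\<zero>\<^bsub>space_at D n\<^esub>)" using g(2) assms(2,3) by metis
  then show ?thesis using linear_map_zero[OF chain_mapD(1)[OF g(1)]] by simp
qed

section \<open>The filtered complex of a factored chain complex\<close>

locale factored =
  fixes X :: "('k::field, 'v) param_complex"
  assumes factored: "factored_chain_complex X"
begin

abbreviation Sp :: "real \<Rightarrow> nat \<Rightarrow> ('k, 'v) module" where "Sp t n \<equiv> space_at (val X t) n"

lemma param_chain_complex: "param_chain_complex X"
  and tame: "tame X" and epimorphic: "epimorphic X"
  using factored unfolding factored_chain_complex_def by auto

lemma is_Ch: "t \<ge> 0 \<Longrightarrow> is_Ch (val X t)"
  and trans_chain_map: "0 \<le> s \<Longrightarrow> s \<le> t \<Longrightarrow> chain_map (val X s) (val X t) (trans_map X s t)"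
  and trans_id: "0 \<le> t \<Longrightarrow> x \<in> carrier (Sp t n) \<Longrightarrow> trans_map X t t n x = x"
  and trans_comp: "0 \<le> r \<Longrightarrow> r \<le> s \<Longrightarrow> s \<le> t \<Longrightarrow> x \<in> carrier (Sp r n) \<Longrightarrow>
      trans_map X s t n (trans_map X r s n x) = trans_map X r t n x"
  using param_chain_complex unfolding param_chain_complex_def by simp_all

lemma right_const: "t \<ge> 0 \<Longrightarrow> right_constant X t"
  and finite_breaks: "finite {t. 0 \<le> t \<and> \<not> left_constant X t}"
  using tame unfolding tame_def by simp_all

lemma trans_surj: "0 \<le> s \<Longrightarrow> s \<le> t \<Longrightarrow> trans_map X s t n ` carrier (Sp s n) = carrier (Sp t n)"
  using epimorphic unfolding epimorphic_def by simp

lemma vs_Sp: "t \<ge> 0 \<Longrightarrow> vs (Sp t n)"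
  using is_Ch[of t] unfolding is_Ch_def by simp

lemma bdry_linear: "t \<ge> 0 \<Longrightarrow> linear_map class_ring (Sp t (Suc n)) (Sp t n) (bdry (val X t) (Suc n))"
  using is_Ch[of t] unfolding is_Ch_def by simp

lemma trans_linear: "0 \<le> s \<Longrightarrow> s \<le> t \<Longrightarrow> linear_map class_ring (Sp s n) (Sp t n) (trans_map X s t n)"
  by (rule chain_mapD(1)[OF trans_chain_map])

lemma coordinates:
  "\<exists>\<beta>E. finite (fst \<beta>E) \<and> (\<forall>f. snd \<beta>E f \<in> carrier (Sp 0 n)) \<and>
     (\<forall>f g. snd \<beta>E (f + g) = snd \<beta>E f \<oplus>\<^bsub>Sp 0 n\<^esub> snd \<beta>E g) \<and>
     (\<forall>c f. snd \<beta>E (fun_scale c f) = c \<odot>\<^bsub>Sp 0 n\<^esub> snd \<beta>E f) \<and>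
     bij_betw (snd \<beta>E) (supported_on (fst \<beta>E :: 'v set)) (carrier (Sp 0 n))"
  using coordinates_exist[OF vs_Sp[of 0 n]] is_Ch[of 0] unfolding is_Ch_def by simp

definition coords :: "nat \<Rightarrow> 'v set \<times> (('v \<Rightarrow> 'k) \<Rightarrow> 'v)" where
  "coords n = (SOME \<beta>E. finite (fst \<beta>E) \<and> (\<forall>f. snd \<beta>E f \<in> carrier (Sp 0 n)) \<and>
     (\<forall>f g. snd \<beta>E (f + g) = snd \<beta>E f \<oplus>\<^bsub>Sp 0 n\<^esub> snd \<beta>E g) \<and>
     (\<forall>c f. snd \<beta>E (fun_scale c f) = c \<odot>\<^bsub>Sp 0 n\<^esub> snd \<beta>E f) \<and>
     bij_betw (snd \<beta>E) (supported_on (fst \<beta>E)) (carrier (Sp 0 n)))"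

definition U :: "nat \<Rightarrow> ('v \<Rightarrow> 'k) set" where "U n = supported_on (fst (coords n))"

definition E :: "nat \<Rightarrow> ('v \<Rightarrow> 'k) \<Rightarrow> 'v" where "E n = snd (coords n)"

lemma
  shows finite_coords: "finite (fst (coords n))"
    and E_closed [simp]: "E n f \<in> carrier (Sp 0 n)"
    and E_add: "E n (f + g) = E n f \<oplus>\<^bsub>Sp 0 n\<^esub> E n g"
    and E_scale: "E n (fun_scale c f) = c \<odot>\<^bsub>Sp 0 n\<^esub> E n f"
    and E_bij: "bij_betw (E n) (U n) (carrier (Sp 0 n))"
  using someI_ex[OF coordinates[of n]] unfolding coords_def[symmetric] E_def[symmetric] U_def[symmetric]
  by blast+

lemma E_cong: "f \<in> U n \<Longrightarrow> g \<in> U n \<Longrightarrow> E n f = E n g \<Longrightarrow> f = g"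
  using E_bij unfolding bij_betw_def inj_on_def by blast

text \<open>Vectors of \<open>X\<^sup>0\<close> are handled through their coordinates \<open>f\<close>, and \<open>E n f\<close> is the vector itself;
  \<open>P t n f\<close> is its image in \<open>X\<^sup>t\<close>, \<open>D\<close> the differential in coordinates (zero in degree \<open>0\<close>), and
  \<open>d\<close> the death time, \<open>\<infinity>\<close> for vectors that never die.\<close>

definition P :: "real \<Rightarrow> nat \<Rightarrow> ('v \<Rightarrow> 'k) \<Rightarrow> 'v" where
  "P t n f = trans_map X 0 t n (E n f)"

definition cd :: "nat \<Rightarrow> 'v \<Rightarrow> 'v \<Rightarrow> 'k" where "cd n = inv_into (U n) (E n)"

lemma cd_in: "v \<in> carrier (Sp 0 n) \<Longrightarrow> cd n v \<in> U n"
  and E_cd: "v \<in> carrier (Sp 0 n) \<Longrightarrow> E n (cd n v) = v"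
  using E_bij[of n] unfolding cd_def by (metis bij_betw_imp_surj_on inv_into_into, metis bij_betw_inv_into_right)

fun D :: "nat \<Rightarrow> ('v \<Rightarrow> 'k) \<Rightarrow> 'v \<Rightarrow> 'k" where
  "D 0 f = 0"
| "D (Suc n) f = cd n (bdry (val X 0) (Suc n) (E (Suc n) f))"

definition d :: "nat \<Rightarrow> ('v \<Rightarrow> 'k) \<Rightarrow> ereal" where
  "d n f = (INF t\<in>{t. 0 \<le> t \<and> P t n f = \<zero>\<^bsub>Sp t n\<^esub>}. ereal t)"

lemma U_subspace: "fs.subspace (U n)"
  unfolding U_def by (rule supported_on_subspace)

lemma P_closed: "t \<ge> 0 \<Longrightarrow> P t n f \<in> carrier (Sp t n)"
  unfolding P_def using linear_map_closed[OF trans_linear] by simp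

lemma P_add: "t \<ge> 0 \<Longrightarrow> P t n (f + g) = P t n f \<oplus>\<^bsub>Sp t n\<^esub> P t n g"
  unfolding P_def E_add using linear_map_add[OF trans_linear] by simp

lemma P_scale: "t \<ge> 0 \<Longrightarrow> P t n (fun_scale c f) = c \<odot>\<^bsub>Sp t n\<^esub> P t n f"
  unfolding P_def E_scale using linear_map_smult[OF trans_linear] by simp

lemma P_trans: "0 \<le> s \<Longrightarrow> s \<le> t \<Longrightarrow> trans_map X s t n (P s n f) = P t n f"
  unfolding P_def by (rule trans_comp) auto

lemma P_surj:
  assumes "t \<ge> 0" "v \<in> carrier (Sp t n)"
  obtains f where "f \<in> U n" "P t n f = v"
proof -
  have "v \<in> trans_map X 0 t n ` carrier (Sp 0 n)" using trans_surj[of 0 t n] assms by simp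
  then obtain u where "u \<in> carrier (Sp 0 n)" "v = trans_map X 0 t n u" by blast
  then show thesis using that[of "cd n u"] cd_in E_cd by (simp add: P_def)
qed

lemma P_0: "P 0 n f = E n f"
  unfolding P_def by (simp add: trans_id)

lemma E_D: "E n (D (Suc n) f) = bdry (val X 0) (Suc n) (E (Suc n) f)"
  using linear_map_closed[OF bdry_linear[of 0 n]] by (simp add: E_cd)

lemma D_in: "D (Suc n) f \<in> U n"
  using linear_map_closed[OF bdry_linear[of 0 n]] by (simp add: cd_in)

declare D.simps(2) [simp del]

lemma P_D: "t \<ge> 0 \<Longrightarrow> P t n (D (Suc n) f) = bdry (val X t) (Suc n) (P (t) (Suc n) f)"
  unfolding P_def E_D using chain_mapD(2)[OF trans_chain_map[of 0 t]] by simp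

lemma E_zero: "E n 0 = \<zero>\<^bsub>Sp 0 n\<^esub>"
proof -
  have "E n 0 = E n (fun_scale 0 0)" by (simp add: fun_scale_def zero_fun_def)
  also have "\<dots> = \<zero>\<^bsub>Sp 0 n\<^esub>" unfolding E_scale by (rule vs_zero_smult[OF vs_Sp]) auto
  finally show ?thesis .
qed

lemma P_zero: "t \<ge> 0 \<Longrightarrow> P t n 0 = \<zero>\<^bsub>Sp t n\<^esub>"
  unfolding P_def E_zero using linear_map_zero[OF trans_linear] by simp

lemma D_add: "D n (f + g) = D n f + D n g"
proof (cases n)
  case (Suc m)
  show ?thesis unfolding Suc
    by (rule E_cong[of _ m])
      (use D_in U_subspace linear_map_add[OF bdry_linear[of 0 m]] in
        \<open>auto simp: E_D E_add fs.subspace_add\<close>)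
qed simp

lemma D_scale: "D n (fun_scale c f) = fun_scale c (D n f)"
proof (cases n)
  case (Suc m)
  show ?thesis unfolding Suc
    by (rule E_cong[of _ m])
      (use D_in U_subspace linear_map_smult[OF bdry_linear[of 0 m]] in
        \<open>auto simp: E_D E_scale fs.subspace_scale\<close>)
qed (simp add: fun_scale_def fun_eq_iff)

lemma D_D: "D n (D (Suc n) f) = 0"
proof (cases n)
  case (Suc m)
  have "bdry (val X 0) (Suc m) (bdry (val X 0) (Suc (Suc m)) (E (Suc (Suc m)) f)) = \<zero>\<^bsub>Sp 0 m\<^esub>"
    using is_Ch[of 0] unfolding is_Ch_def by simp
  then have "E m (D (Suc m) (D (Suc (Suc m)) f)) = E m 0"
    by (simp add: E_D E_zero)
  then show ?thesis unfolding Suc using E_cong D_in U_subspace fs.subspace_0 by blast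
qed simp

lemma P_vanish_mono:
  assumes "0 \<le> s" "s \<le> t" "P s n f = \<zero>\<^bsub>Sp s n\<^esub>"
  shows "P t n f = \<zero>\<^bsub>Sp t n\<^esub>"
  using P_trans[OF assms(1,2), of n f] linear_map_zero[OF trans_linear[OF assms(1,2), of n]] assms(3) by simp

lemma d_nonneg: "0 \<le> d n f"
  unfolding d_def by (rule INF_greatest) simp

text \<open>Right-constancy makes the infimum in \<open>d\<close> attained: a vector with death time
  at most \<open>t\<close> vanishes somewhere before \<open>t + \<epsilon>\<close>, hence at
  \<open>t + \<epsilon>\<close>, and the map from time \<open>t\<close> to
  \<open>t + \<epsilon>\<close> is injective.\<close>

lemma P_eq_zero_iff:
  assumes t: "t \<ge> 0"
  shows "P t n f = \<zero>\<^bsub>Sp t n\<^esub> \<longleftrightarrow> d n f \<le> ereal t"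
proof
  assume "P t n f = \<zero>\<^bsub>Sp t n\<^esub>"
  then show "d n f \<le> ereal t" unfolding d_def using t by (intro INF_lower) simp
next
  assume le: "d n f \<le> ereal t"
  obtain \<epsilon> where \<epsilon>: "\<epsilon> > 0"
      "\<And>\<delta>. 0 \<le> \<delta> \<Longrightarrow> \<delta> \<le> \<epsilon> \<Longrightarrow> chain_iso (val X t) (val X (t + \<delta>)) (trans_map X t (t + \<delta>))"
    using right_const[OF t] unfolding right_constant_def by blast
  have "d n f < ereal (t + \<epsilon>)" using le \<epsilon>(1) by (metis ereal_less_eq(3) less_add_same_cancel1 less_ereal.simps(1) order_le_less_trans)
  then obtain s where s: "0 \<le> s" "P s n f = \<zero>\<^bsub>Sp s n\<^esub>" "s < t + \<epsilon>"
    unfolding d_def INF_less_iff by auto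
  have "P (t + \<epsilon>) n f = \<zero>\<^bsub>Sp (t + \<epsilon>) n\<^esub>" using P_vanish_mono[OF s(1) _ s(2)] s(3) by simp
  then have "trans_map X t (t + \<epsilon>) n (P t n f) = \<zero>\<^bsub>Sp (t + \<epsilon>) n\<^esub>" using P_trans t \<epsilon>(1) by simp
  then show "P t n f = \<zero>\<^bsub>Sp t n\<^esub>"
    using chain_iso_inj[OF \<epsilon>(2)[of \<epsilon>] P_closed[OF t]] \<epsilon>(1) by simp
qed

text \<open>Left-constancy fails at every positive finite death time: otherwise the map from
  slightly earlier is injective and the vector was dead already. So the values are among these
  finitely many points, 0 and \<infinity>.\<close>

lemma d_finite_range: "finite (range (d n))"
proof -
  have "d n f \<in> insert \<infinity> (ereal ` {t. 0 \<le> t \<and> \<not> left_constant X t}) \<union> {0}" for f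
  proof (rule ccontr)
    assume *: "\<not> ?thesis"
    then obtain t where t: "d n f = ereal t" using d_nonneg[of n f] by (cases "d n f") auto
    have t0: "t \<ge> 0" "t \<noteq> 0" using d_nonneg[of n f] * t by (auto simp: zero_ereal_def)
    then have "left_constant X t" using * t by auto
    then obtain \<epsilon> where \<epsilon>: "\<epsilon> > 0" "\<epsilon> \<le> t"
      "chain_iso (val X (t - \<epsilon>)) (val X t) (trans_map X (t - \<epsilon>) t)"
      using t0 unfolding left_constant_def by (metis less_eq_real_def)
    have "P t n f = \<zero>\<^bsub>Sp t n\<^esub>" using P_eq_zero_iff t t0 by simp
    then have "trans_map X (t - \<epsilon>) t n (P (t - \<epsilon>) n f) = \<zero>\<^bsub>Sp t n\<^esub>" using P_trans \<epsilon> by simp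
    then have "P (t - \<epsilon>) n f = \<zero>\<^bsub>Sp (t - \<epsilon>) n\<^esub>" using chain_iso_inj[OF \<epsilon>(3) P_closed] \<epsilon> by simp
    then show False using P_eq_zero_iff[of "t - \<epsilon>" n f] t \<epsilon> by simp
  qed
  then have "range (d n) \<subseteq> insert \<infinity> (ereal ` {t. 0 \<le> t \<and> \<not> left_constant X t}) \<union> {0}" by blast
  then show ?thesis by (rule finite_subset) (use finite_breaks in simp)
qed

text \<open>Evaluating at \<open>t = c\<close> suffices when \<open>c\<close> is finite, and an
  infinite \<open>c\<close> bounds everything.\<close>

lemma d_leI:
  assumes "0 \<le> c" "\<And>t. 0 \<le> t \<Longrightarrow> c \<le> ereal t \<Longrightarrow> P t n f = \<zero>\<^bsub>Sp t n\<^esub>"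
  shows "d n f \<le> c"
proof (cases c)
  case (real r)
  then show ?thesis using assms P_eq_zero_iff[of r n f] by simp
qed (use assms in auto)

lemma d_ultra: "fs.ultra_seminorm (d n)"
  unfolding fs.ultra_seminorm_def
proof (intro conjI allI)
  fix f g
  show "d n (f + g) \<le> max (d n f) (d n g)"
  proof (rule d_leI)
    fix t :: real assume t: "0 \<le> t" "max (d n f) (d n g) \<le> ereal t"
    have "P t n f = \<zero>\<^bsub>Sp t n\<^esub>" "P t n g = \<zero>\<^bsub>Sp t n\<^esub>" using t P_eq_zero_iff by auto
    then show "P t n (f + g) = \<zero>\<^bsub>Sp t n\<^esub>" using t P_add vs_add_zero[OF vs_Sp] by simp
  qed (simp add: d_nonneg le_max_iff_disj)
next
  fix c f
  show "d n (fun_scale c f) \<le> d n f"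
  proof (rule d_leI)
    fix t :: real assume t: "0 \<le> t" "d n f \<le> ereal t"
    have "P t n f = \<zero>\<^bsub>Sp t n\<^esub>" using t P_eq_zero_iff by auto
    then show "P t n (fun_scale c f) = \<zero>\<^bsub>Sp t n\<^esub>" using t P_scale vs_smult_zero[OF vs_Sp] by simp
  qed (simp add: d_nonneg)
qed

lemma d_D: "d n (D (Suc n) f) \<le> d (Suc n) f"
proof (rule d_leI)
  fix t :: real assume t: "0 \<le> t" "d (Suc n) f \<le> ereal t"
  then show "P t n (D (Suc n) f) = \<zero>\<^bsub>Sp t n\<^esub>"
    using P_eq_zero_iff[of t "Suc n" f] linear_map_zero[OF bdry_linear[of t n]]
    by (simp add: P_D)
qed (rule d_nonneg)

lemma d_zero: "d n 0 = 0"
  using P_eq_zero_iff[of 0 n 0] P_zero[of 0] d_nonneg[of n 0] by (simp add: zero_ereal_def[symmetric])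

lemma d_pos: "f \<in> U n \<Longrightarrow> d n f \<le> 0 \<Longrightarrow> f = 0"
  using P_eq_zero_iff[of 0 n f] E_cong[of f n 0] U_subspace[of n] fs.subspace_0
  by (auto simp: P_0 E_zero zero_ereal_def[symmetric])

sublocale filtered_complex fun_scale U D d
  using U_subspace supported_on_span[OF finite_coords] D_add D_scale D_in D_D d_ultra d_finite_range d_pos d_zero
  by unfold_locales (simp_all add: U_def)

end

section \<open>Direct sums of interval functors\<close>

abbreviation bar_sum ::
  "(nat \<Rightarrow> tagged_interval multiset) \<Rightarrow> ('k::field, nat \<Rightarrow> tagged_interval \<times> nat \<Rightarrow> 'k) param_complex" where
  "bar_sum B \<equiv> direct_sum_param UNIV (\<lambda>n. direct_sum_mset (B n) (interval_functor n))"

text \<open>For a tagged interval, the condition that degree \<open>k\<close> of the interval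
  functor at \<open>r\<close> is one-dimensional, for disk, sphere and zero complex together. In
  these terms every internal map multiplies by 0 or 1.\<close>

definition alive :: "nat \<Rightarrow> tagged_interval \<Rightarrow> real \<Rightarrow> nat \<Rightarrow> bool" where
  "alive n I r k \<longleftrightarrow> k = n \<and> ereal r < snd I \<or> Suc k = n \<and> ereal r < fst I"

definition tagged_bars :: "(nat \<Rightarrow> tagged_interval multiset) \<Rightarrow> bool" where
  "tagged_bars B \<longleftrightarrow> (\<forall>n. \<forall>I\<in>#B n. is_tagged_interval I) \<and> (\<forall>I\<in>#B 0. fst I = 0)"

lemma tagged_bars_copies:
  assumes "tagged_bars B" "p \<in> copies (B n)"
  shows "0 < snd (fst p)" "0 \<le> fst (fst p)" "fst (fst p) \<le> snd (fst p)" "n = 0 \<Longrightarrow> fst (fst p) = 0"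
proof -
  have "is_tagged_interval (fst p)" and 0: "n = 0 \<Longrightarrow> fst (fst p) = 0"
    using assms(1) fst_copies[OF assms(2)] unfolding tagged_bars_def by auto
  then show "0 < snd (fst p)" "0 \<le> fst (fst p)" "fst (fst p) \<le> snd (fst p)"
    unfolding is_tagged_interval_def by (simp_all add: case_prod_unfold)
  show "n = 0 \<Longrightarrow> fst (fst p) = 0" by (rule 0)
qed

lemma direct_sum_mset_copies: "direct_sum_mset M X = direct_sum_param (copies M) (\<lambda>p. X (fst p))"
  unfolding direct_sum_mset_def copies_def case_prod_unfold ..

lemma interval_functor_space:
  assumes "fst I \<le> snd I"
  shows "space_at (val (interval_functor n I) r) k = (if alive n I r k then field_space else zero_space)"
proof -
  obtain s t where "I = (s, t)" by (cases I)
  then show ?thesis using assms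
    by (auto simp: interval_functor_def alive_def disk_def sphere_def zero_complex_def)
qed

lemma interval_functor_bdry:
  "bdry (val (interval_functor n I) r) k x = (if k = n \<and> ereal r < fst I then x else 0)"
  by (cases I) (auto simp: interval_functor_def disk_def sphere_def zero_complex_def)

text \<open>The last hypothesis says that \<open>x\<close> lies in the value at \<open>q\<close>.
  For such \<open>x\<close>, each of the identity, \<open>\<Psi>\<close> and 0 is truncation to the
  degrees alive at \<open>r\<close>.\<close>

lemma interval_functor_trans:
  assumes "fst I \<le> snd I" "q \<le> r" "\<not> alive n I q k \<Longrightarrow> x = 0"
  shows "trans_map (interval_functor n I) q r k x = (if alive n I r k then x else 0)"
proof -
  obtain s t where I: "I = (s, t)" by (cases I)
  have "ereal q \<le> ereal r" using assms(2) by simp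
  then show ?thesis using assms unfolding I
    by (auto simp: interval_functor_def alive_def disk_to_sphere_def)
qed

lemma zero_space_simps:
  "\<zero>\<^bsub>field_space\<^esub> = 0" "\<zero>\<^bsub>zero_space\<^esub> = 0" "x \<oplus>\<^bsub>field_space\<^esub> y = x + y" "x \<oplus>\<^bsub>zero_space\<^esub> y = x + y"
  "c \<odot>\<^bsub>field_space\<^esub> x = c * x" "c \<odot>\<^bsub>zero_space\<^esub> x = c * x"
  "carrier field_space = UNIV" "carrier zero_space = {0}"
  by (simp_all add: field_space_def zero_space_def)

lemmas bar_sum_defs =
  direct_sum_mset_copies direct_sum_param_def direct_sum_complex_def direct_sum_space_def

lemma bar_sum_ops:
  fixes f g :: "nat \<Rightarrow> tagged_interval \<times> nat \<Rightarrow> 'k::field"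
  assumes B: "tagged_bars B"
  shows bar_sum_zero: "\<zero>\<^bsub>space_at (val (bar_sum B) r) k\<^esub> = (\<lambda>n. \<lambda>p\<in>copies (B n). 0 :: 'k)"
    and bar_sum_add: "f \<oplus>\<^bsub>space_at (val (bar_sum B) r) k\<^esub> g = (\<lambda>n. \<lambda>p\<in>copies (B n). f n p + g n p)"
    and bar_sum_smult: "c \<odot>\<^bsub>space_at (val (bar_sum B) r) k\<^esub> f = (\<lambda>n. \<lambda>p\<in>copies (B n). c * f n p)"
    and bar_sum_bdry: "bdry (val (bar_sum B) r) k f =
      (\<lambda>n. \<lambda>p\<in>copies (B n). if k = n \<and> ereal r < fst (fst p) then f n p else 0)"
proof -
  have sp: "space_at (val (interval_functor n (fst p) :: ('k, _) param_complex) r) k =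
      (if alive n (fst p) r k then field_space else zero_space)" if "p \<in> copies (B n)" for n p
    using interval_functor_space tagged_bars_copies[OF B that] by blast
  show "\<zero>\<^bsub>space_at (val (bar_sum B) r) k\<^esub> = (\<lambda>n. \<lambda>p\<in>copies (B n). 0 :: 'k)"
    by (intro ext) (simp add: bar_sum_defs sp zero_space_simps restrict_def)
  show "f \<oplus>\<^bsub>space_at (val (bar_sum B) r) k\<^esub> g = (\<lambda>n. \<lambda>p\<in>copies (B n). f n p + g n p)"
    by (intro ext) (simp add: bar_sum_defs sp zero_space_simps restrict_def)
  show "c \<odot>\<^bsub>space_at (val (bar_sum B) r) k\<^esub> f = (\<lambda>n. \<lambda>p\<in>copies (B n). c * f n p)"
    by (intro ext) (simp add: bar_sum_defs sp zero_space_simps restrict_def)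
  show "bdry (val (bar_sum B) r) k f =
      (\<lambda>n. \<lambda>p\<in>copies (B n). if k = n \<and> ereal r < fst (fst p) then f n p else 0)"
    by (simp add: bar_sum_defs interval_functor_bdry restrict_def fun_eq_iff)
qed

definition bar_carrier :: "(nat \<Rightarrow> tagged_interval multiset) \<Rightarrow> real \<Rightarrow> nat \<Rightarrow>
    (nat \<Rightarrow> tagged_interval \<times> nat \<Rightarrow> 'k::field) set" where
  "bar_carrier B r k = {f. \<forall>n. f n \<in> extensional (copies (B n)) \<and>
     (\<forall>p\<in>copies (B n). \<not> alive n (fst p) r k \<longrightarrow> f n p = 0)}"

text \<open>Both finiteness conditions of the nested direct sum hold automatically:
  \<open>B n\<close> has finitely many copies, and degree \<open>k\<close> sees only the bars of
  degrees \<open>k\<close> and \<open>k + 1\<close>.\<close>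

lemma bar_sum_carrier:
  assumes B: "tagged_bars B"
  shows "carrier (space_at (val (bar_sum B) r) k) = (bar_carrier B r k :: (nat \<Rightarrow> _ \<Rightarrow> 'k::field) set)"
proof -
  have sp: "space_at (val (interval_functor n (fst p) :: ('k, _) param_complex) r) k =
      (if alive n (fst p) r k then field_space else zero_space)" if "p \<in> copies (B n)" for n p
    using interval_functor_space tagged_bars_copies[OF B that] by blast
  let ?V = "\<lambda>n. direct_sum_space (copies (B n)) (\<lambda>p. space_at (val (interval_functor n (fst p)) r) k)
     :: ('k, _) module"
  have inner: "f \<in> carrier (?V n) \<longleftrightarrow> f \<in> extensional (copies (B n)) \<and>
     (\<forall>p\<in>copies (B n). \<not> alive n (fst p) r k \<longrightarrow> f p = 0)" for f n
  proof -
    have "f p \<in> carrier (space_at (val (interval_functor n (fst p)) r) k) \<longleftrightarrow>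
        (\<not> alive n (fst p) r k \<longrightarrow> f p = 0)" if "p \<in> copies (B n)" for p
      using sp[OF that] by (simp add: zero_space_simps)
    then show ?thesis
      using finite_copies[of "B n"] by (simp add: direct_sum_space_def PiE_def Pi_iff conj_commute)
  qed
  have zero: "\<zero>\<^bsub>?V n\<^esub> = (\<lambda>p\<in>copies (B n). 0)" for n
    by (intro ext) (simp add: direct_sum_space_def restrict_def sp zero_space_simps)
  have fin: "finite {n. f n \<noteq> \<zero>\<^bsub>?V n\<^esub>}" if "\<And>n. f n \<in> carrier (?V n)" for f
  proof (rule finite_subset)
    show "{n. f n \<noteq> \<zero>\<^bsub>?V n\<^esub>} \<subseteq> {k, Suc k}"
    proof
      fix n assume n: "n \<in> {n. f n \<noteq> \<zero>\<^bsub>?V n\<^esub>}"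
      have "f n = \<zero>\<^bsub>?V n\<^esub>" if "n \<noteq> k" "n \<noteq> Suc k"
      proof -
        have "\<not> alive n I r k" for I using that by (auto simp: alive_def)
        then show ?thesis using \<open>f n \<in> carrier (?V n)\<close>[unfolded inner] unfolding zero
          by (auto simp: extensional_def restrict_def fun_eq_iff)
      qed
      then show "n \<in> {k, Suc k}" using n by blast
    qed
  qed simp
  have "carrier (space_at (val (bar_sum B) r) k) = {f. (\<forall>n. f n \<in> carrier (?V n)) \<and> finite {n. f n \<noteq> \<zero>\<^bsub>?V n\<^esub>}}"
    unfolding direct_sum_param_def direct_sum_mset_copies direct_sum_complex_def
    by (simp add: direct_sum_space_def[of UNIV] PiE_def Pi_iff)
  also have "\<dots> = {f. \<forall>n. f n \<in> carrier (?V n)}" using fin by blast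
  also have "\<dots> = bar_carrier B r k" unfolding bar_carrier_def inner ..
  finally show ?thesis .
qed

lemma bar_sum_trans:
  assumes B: "tagged_bars B" and "q \<le> r" "f \<in> bar_carrier B q k"
  shows "trans_map (bar_sum B) q r k f =
      (\<lambda>n. \<lambda>p\<in>copies (B n). if alive n (fst p) r k then f n p else (0 :: 'k::field))"
proof (intro ext)
  fix n p
  show "trans_map (bar_sum B) q r k f n p =
      (\<lambda>p\<in>copies (B n). if alive n (fst p) r k then f n p else 0) p"
  proof (cases "p \<in> copies (B n)")
    case True
    have "\<not> alive n (fst p) q k \<Longrightarrow> f n p = 0" using assms(3) True unfolding bar_carrier_def by blast
    from interval_functor_trans[OF tagged_bars_copies(3)[OF B True] assms(2) this] True
    show ?thesis
      by (simp add: direct_sum_param_def direct_sum_mset_copies)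
  next
    case False
    then show ?thesis
      by (simp add: direct_sum_param_def direct_sum_mset_copies)
  qed
qed

lemma bar_sum_vs:
  assumes B: "tagged_bars B"
  shows "vs (space_at (val (bar_sum B :: ('k::field, _) param_complex) r) k)"
proof -
  let ?V = "space_at (val (bar_sum B :: ('k, _) param_complex) r) k"
  note simps = bar_sum_carrier[OF B] bar_sum_zero[OF B] bar_sum_add[OF B] bar_sum_smult[OF B]
  have ab: "abelian_group ?V"
  proof (rule abelian_groupI, unfold simps)
    fix x :: "nat \<Rightarrow> tagged_interval \<times> nat \<Rightarrow> 'k" assume x: "x \<in> bar_carrier B r k"
    show "(\<lambda>n. \<lambda>p\<in>copies (B n). (\<lambda>p\<in>copies (B n). 0) p + x n p) = x"
      by (intro ext) (use x in \<open>auto simp: bar_carrier_def restrict_def extensional_def\<close>)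
    show "\<exists>y\<in>bar_carrier B r k. (\<lambda>n. \<lambda>p\<in>copies (B n). y n p + x n p) = (\<lambda>n. \<lambda>p\<in>copies (B n). 0)"
      by (rule bexI[of _ "\<lambda>n. \<lambda>p\<in>copies (B n). - x n p"]) (use x in \<open>auto simp: bar_carrier_def restrict_def fun_eq_iff extensional_def\<close>)
  qed (auto simp: bar_carrier_def restrict_def fun_eq_iff extensional_def add_ac)
  have "Module.module class_ring ?V"
  proof (rule moduleI[OF _ ab], unfold simps)
    show "cring (class_ring :: 'k ring)" by (rule class_cring.cring_axioms)
    fix x :: "nat \<Rightarrow> tagged_interval \<times> nat \<Rightarrow> 'k" assume x: "x \<in> bar_carrier B r k"
    show "(\<lambda>n. \<lambda>p\<in>copies (B n). \<one>\<^bsub>class_ring\<^esub> * x n p) = x"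
      by (intro ext) (use x in \<open>auto simp: bar_carrier_def restrict_def extensional_def\<close>)
  qed (auto simp: bar_carrier_def restrict_def fun_eq_iff extensional_def algebra_simps)
  then show ?thesis by (intro vectorspace.intro class_field.field_axioms)
qed

section \<open>Isomorphisms from natural bijections\<close>

lemma linear_map_inv_into:
  fixes V :: "('k::field, 'v) module" and W :: "('k, 'w) module"
  assumes f: "linear_map class_ring V W f" and bij: "bij_betw f (carrier V) (carrier W)"
  shows "linear_map class_ring W V (inv_into (carrier V) f)"
proof (rule linear_mapI)
  show vs: "vs V" "vs W" using f by (simp_all add: linear_map_def)
  let ?g = "inv_into (carrier V) f"
  have g: "?g y \<in> carrier V" "f (?g y) = y" if "y \<in> carrier W" for y
    using that bij by (auto simp: bij_betw_def inv_into_into f_inv_into_f)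
  have gI: "?g y = x" if "x \<in> carrier V" "f x = y" for x y
    using that bij_betw_inv_into_left[OF bij] by blast
  fix x y c assume x: "x \<in> carrier W"
  show "?g x \<in> carrier V" using g x by simp
  show "?g (c \<odot>\<^bsub>W\<^esub> x) = c \<odot>\<^bsub>V\<^esub> ?g x"
    using g[OF x] by (intro gI) (simp_all add: vs_smult_closed[OF vs(1)] linear_map_smult[OF f])
  assume y: "y \<in> carrier W"
  show "?g (x \<oplus>\<^bsub>W\<^esub> y) = ?g x \<oplus>\<^bsub>V\<^esub> ?g y"
    using g[OF x] g[OF y] by (intro gI) (simp_all add: vs_add_closed[OF vs(1)] linear_map_add[OF f])
qed

text \<open>The inverse of a natural family of bijective chain maps is again one. \<open>F\<close>
  runs from \<open>Y\<close> to \<open>X\<close> because a bar sum maps to \<open>X\<close> by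
  sending coefficients to combinations of generators.\<close>

lemma param_isomorphicI:
  fixes X :: "('k::field, 'v) param_complex" and Y :: "('k, 'w) param_complex"
  assumes lin: "\<And>t n. 0 \<le> t \<Longrightarrow>
      linear_map class_ring (space_at (val Y t) n) (space_at (val X t) n) (F t n)"
    and bij: "\<And>t n. 0 \<le> t \<Longrightarrow>
      bij_betw (F t n) (carrier (space_at (val Y t) n)) (carrier (space_at (val X t) n))"
    and bdry_closed: "\<And>t n y. 0 \<le> t \<Longrightarrow> y \<in> carrier (space_at (val Y t) (Suc n)) \<Longrightarrow>
      bdry (val Y t) (Suc n) y \<in> carrier (space_at (val Y t) n)"
    and bdry: "\<And>t n y. 0 \<le> t \<Longrightarrow> y \<in> carrier (space_at (val Y t) (Suc n)) \<Longrightarrow>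
      F t n (bdry (val Y t) (Suc n) y) = bdry (val X t) (Suc n) (F t (Suc n) y)"
    and trans_closed: "\<And>s t n y. 0 \<le> s \<Longrightarrow> s \<le> t \<Longrightarrow> y \<in> carrier (space_at (val Y s) n) \<Longrightarrow>
      trans_map Y s t n y \<in> carrier (space_at (val Y t) n)"
    and trans: "\<And>s t n y. 0 \<le> s \<Longrightarrow> s \<le> t \<Longrightarrow> y \<in> carrier (space_at (val Y s) n) \<Longrightarrow>
      F t n (trans_map Y s t n y) = trans_map X s t n (F s n y)"
  shows "X \<cong>\<^sub>p Y"
proof -
  define G where "G t n = inv_into (carrier (space_at (val Y t) n)) (F t n)" for t n
  have GF: "G t n (F t n y) = y" if "0 \<le> t" "y \<in> carrier (space_at (val Y t) n)" for t n y
    unfolding G_def using bij_betw_inv_into_left[OF bij[OF that(1)] that(2)] .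
  have FG: "F t n (G t n x) = x" if "0 \<le> t" "x \<in> carrier (space_at (val X t) n)" for t n x
    unfolding G_def using bij_betw_inv_into_right[OF bij[OF that(1)] that(2)] .
  have G_lin: "linear_map class_ring (space_at (val X t) n) (space_at (val Y t) n) (G t n)" if "0 \<le> t" for t n
    unfolding G_def by (rule linear_map_inv_into[OF lin bij]) (use that in auto)
  have G_closed: "G t n x \<in> carrier (space_at (val Y t) n)"
    if "0 \<le> t" "x \<in> carrier (space_at (val X t) n)" for t n x
    using linear_map_closed[OF G_lin] that by blast
  have G_bdry: "G t n (bdry (val X t) (Suc n) x) = bdry (val Y t) (Suc n) (G t (Suc n) x)"
    if "0 \<le> t" "x \<in> carrier (space_at (val X t) (Suc n))" for t n x
    using GF[OF that(1) bdry_closed[OF that(1) G_closed[OF that]]]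
    by (simp add: bdry[OF that(1) G_closed[OF that]] FG[OF that])
  have G_trans: "G t n (trans_map X s t n x) = trans_map Y s t n (G s n x)"
    if "0 \<le> s" "s \<le> t" "x \<in> carrier (space_at (val X s) n)" for s t n x
    using GF[OF _ trans_closed[OF that(1,2) G_closed[OF that(1,3)]]] that
    by (simp add: trans[OF that(1,2) G_closed[OF that(1,3)]] FG[OF that(1,3)])
  have "param_morphism X Y G"
    unfolding param_morphism_def chain_map_def using G_lin G_bdry G_trans by simp
  moreover have "param_morphism Y X F"
    unfolding param_morphism_def chain_map_def using lin bdry trans by simp
  ultimately show ?thesis
    unfolding param_isomorphic_def using GF FG by (intro exI[of _ G] exI[of _ F]) simp
qed

context factored
begin

section \<open>Realizations\<close>

text \<open>The two sums are the two ways in which a bar reaches degree \<open>n\<close>: as the top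
  of a disk or a sphere, and as the bottom of a disk.\<close>

definition comb :: "(nat \<Rightarrow> tagged_interval multiset) \<Rightarrow> (nat \<Rightarrow> tagged_interval \<times> nat \<Rightarrow> 'v \<Rightarrow> 'k) \<Rightarrow>
    nat \<Rightarrow> (tagged_interval \<times> nat \<Rightarrow> 'k) \<Rightarrow> (tagged_interval \<times> nat \<Rightarrow> 'k) \<Rightarrow> 'v \<Rightarrow> 'k" where
  "comb B x n a b = (\<Sum>p\<in>copies (B n). fun_scale (a p) (x n p)) +
     (\<Sum>p\<in>copies (B (Suc n)). fun_scale (b p) (D (Suc n) (x (Suc n) p)))"

text \<open>\<open>x n p\<close> is the generator in degree \<open>n\<close> of the bar with index \<open>p\<close>. The last condition says that
  \<open>x n p\<close> dies at the end of its bar, its boundary dies at the tag, and no cancellation occurs.\<close>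

definition realizes :: "(nat \<Rightarrow> tagged_interval multiset) \<Rightarrow> (nat \<Rightarrow> tagged_interval \<times> nat \<Rightarrow> 'v \<Rightarrow> 'k) \<Rightarrow> bool" where
  "realizes B x \<longleftrightarrow> (\<forall>n. \<forall>p\<in>copies (B n). x n p \<in> U n) \<and>
     (\<forall>n. \<forall>v\<in>U n. \<exists>a b. v = comb B x n a b) \<and>
     (\<forall>n a b t. 0 \<le> t \<longrightarrow> (P t n (comb B x n a b) = \<zero>\<^bsub>Sp t n\<^esub> \<longleftrightarrow>
        (\<forall>p\<in>copies (B n). a p \<noteq> 0 \<longrightarrow> snd (fst p) \<le> ereal t) \<and>
        (\<forall>p\<in>copies (B (Suc n)). b p \<noteq> 0 \<longrightarrow> fst (fst p) \<le> ereal t)))"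

lemma realizesD:
  assumes "realizes B x"
  shows realizes_in: "p \<in> copies (B n) \<Longrightarrow> x n p \<in> U n"
    and realizes_span: "v \<in> U n \<Longrightarrow> \<exists>a b. v = comb B x n a b"
    and realizes_kernel: "0 \<le> t \<Longrightarrow> P t n (comb B x n a b) = \<zero>\<^bsub>Sp t n\<^esub> \<longleftrightarrow>
        (\<forall>p\<in>copies (B n). a p \<noteq> 0 \<longrightarrow> snd (fst p) \<le> ereal t) \<and>
        (\<forall>p\<in>copies (B (Suc n)). b p \<noteq> 0 \<longrightarrow> fst (fst p) \<le> ereal t)"
  using assms unfolding realizes_def by simp_all

lemma comb_add: "comb B x n (\<lambda>p. a p + a' p) (\<lambda>p. b p + b' p) = comb B x n a b + comb B x n a' b'"
  unfolding comb_def by (simp add: fs.scale_left_distrib sum.distrib add_ac)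

lemma comb_scale: "comb B x n (\<lambda>p. c * a p) (\<lambda>p. c * b p) = fun_scale c (comb B x n a b)"
  unfolding comb_def by (simp add: fs.scale_right_distrib fs.scale_sum_right)

lemma comb_cong:
  assumes "\<And>p. p \<in> copies (B n) \<Longrightarrow> a p = a' p" "\<And>p. p \<in> copies (B (Suc n)) \<Longrightarrow> b p = b' p"
  shows "comb B x n a b = comb B x n a' b'"
  unfolding comb_def using assms by (intro arg_cong2[where f="(+)"] sum.cong) auto

lemma comb_single:
  assumes "p \<in> copies (B n)"
  shows "comb B x n (\<lambda>q. if q = p then 1 else 0) (\<lambda>_. 0) = x n p"
proof -
  have "(\<Sum>q\<in>copies (B n). fun_scale (if q = p then 1 else 0) (x n q)) =
      (\<Sum>q\<in>copies (B n). if q = p then x n q else 0)"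
    by (intro sum.cong) auto
  then show ?thesis using assms by (simp add: comb_def finite_copies)
qed

lemma comb_single_D:
  assumes "p \<in> copies (B (Suc n))"
  shows "comb B x n (\<lambda>_. 0) (\<lambda>q. if q = p then 1 else 0) = D (Suc n) (x (Suc n) p)"
proof -
  have "(\<Sum>q\<in>copies (B (Suc n)). fun_scale (if q = p then 1 else 0) (D (Suc n) (x (Suc n) q))) =
      (\<Sum>q\<in>copies (B (Suc n)). if q = p then D (Suc n) (x (Suc n) q) else 0)"
    by (intro sum.cong) (auto)
  then show ?thesis using assms by (simp add: comb_def finite_copies)
qed

text \<open>Since \<open>D\<close> kills boundaries, the generator coefficients of an element become
  the boundary coefficients of its differential. Kernels one degree lower thus test these
  coefficients against tags.\<close>

lemma D_comb: "D (Suc n) (comb B x (Suc n) a b) = comb B x n (\<lambda>_. 0) a"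
  unfolding comb_def fs.scale_zero_left D_add D_sum by (simp add: D_D)

lemma realization_exists:
  obtains B x where "tagged_bars B" "realizes B x"
proof -
  obtain T where T: "\<And>n. finite (T n)" "\<And>n. T n \<subseteq> U n" "\<And>n. 0 \<notin> T n"
    "\<And>n v. v \<in> U n \<Longrightarrow>
       \<exists>a b. v = (\<Sum>x\<in>T n. fun_scale (a x) x) + (\<Sum>x\<in>T (Suc n). fun_scale (b x) (D (Suc n) x))"
    "\<And>n a b x. x \<in> T n \<Longrightarrow> a x \<noteq> 0 \<Longrightarrow>
       d n x \<le> d n ((\<Sum>x\<in>T n. fun_scale (a x) x) + (\<Sum>x\<in>T (Suc n). fun_scale (b x) (D (Suc n) x)))"
    "\<And>n a b x. x \<in> T (Suc n) \<Longrightarrow> b x \<noteq> 0 \<Longrightarrow>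
       d n (D (Suc n) x) \<le> d n ((\<Sum>x\<in>T n. fun_scale (a x) x) + (\<Sum>x\<in>T (Suc n). fun_scale (b x) (D (Suc n) x)))"
    by (fact adapted_basis)
  \<comment> \<open>The bar of a basis vector ends when the vector dies and has its tag where its
    boundary dies; for \<open>n = 0\<close> the boundary and hence the tag is 0.\<close>
  define h where "h n v = (d (n - 1) (D n v), d n v)" for n v
  define B where "B n = image_mset (h n) (mset_set (T n))" for n
  have "\<exists>\<pi>. bij_betw \<pi> (copies (B n)) (T n) \<and> (\<forall>p\<in>copies (B n). h n (\<pi> p) = fst p)" for n
    using copies_image_mset_bij[OF T(1)[of n], of "h n"] unfolding B_def by metis
  then obtain x where x: "\<And>n. bij_betw (x n) (copies (B n)) (T n)"
    and hx: "\<And>n p. p \<in> copies (B n) \<Longrightarrow> h n (x n p) = fst p" by metis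
  have xT: "x n p \<in> T n" if "p \<in> copies (B n)" for n p using x that bij_betw_apply by metis
  define y where "y n = inv_into (copies (B n)) (x n)" for n
  have y: "y n (x n p) = p" if "p \<in> copies (B n)" for n p
    unfolding y_def using x that by (rule bij_betw_inv_into_left)
  have comb_T: "comb B x n a b = (\<Sum>v\<in>T n. fun_scale (a (y n v)) v) +
      (\<Sum>v\<in>T (Suc n). fun_scale (b (y (Suc n) v)) (D (Suc n) v))" for n a b
    unfolding comb_def sum.reindex_bij_betw[OF x, symmetric]
    by (intro arg_cong2[where f="(+)"] sum.cong) (auto simp: y)
  have comb_T': "comb B x n (\<lambda>p. a (x n p)) (\<lambda>p. b (x (Suc n) p)) = (\<Sum>v\<in>T n. fun_scale (a v) v) +
      (\<Sum>v\<in>T (Suc n). fun_scale (b v) (D (Suc n) v))" for n a b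
    unfolding comb_def sum.reindex_bij_betw[OF x, symmetric] ..
  have dx: "d n (x n p) = snd (fst p)" and dDx: "d (n - 1) (D n (x n p)) = fst (fst p)"
    if "p \<in> copies (B n)" for n p
    using hx[OF that] unfolding h_def by (metis snd_conv, metis fst_conv)
  have dDx': "d n (D (Suc n) (x (Suc n) p)) = fst (fst p)" if "p \<in> copies (B (Suc n))" for n p
    using dDx[OF that] by (simp)
  have "is_tagged_interval I" if I: "I \<in># B n" for n I
  proof -
    obtain v where v: "v \<in> T n" "I = h n v" using I T(1) unfolding B_def by auto
    then have "0 < d n v" using d_pos[of v n] T(2,3) not_less by blast
    moreover have "d (n - 1) (D n v) \<le> d n v"
      using d_D[of "n - 1" v] d_nonneg by (cases n) (simp_all add: d_zero)
    ultimately show ?thesis using v d_nonneg by (simp add: is_tagged_interval_def h_def)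
  qed
  moreover have "fst I = 0" if "I \<in># B 0" for I
    using that T(1) unfolding B_def h_def by (auto simp: d_zero)
  ultimately have "tagged_bars B" unfolding tagged_bars_def by blast
  moreover have "realizes B x"
    unfolding realizes_def
  proof (intro conjI allI ballI impI)
    show "x n p \<in> U n" if "p \<in> copies (B n)" for n p using xT[OF that] T(2) by blast
    show "\<exists>a b. v = comb B x n a b" if v: "v \<in> U n" for n v
    proof -
      obtain a b where "v = (\<Sum>x\<in>T n. fun_scale (a x) x) + (\<Sum>x\<in>T (Suc n). fun_scale (b x) (D (Suc n) x))"
        using T(4)[OF v] by iprover
      then show ?thesis unfolding comb_T'[symmetric] by iprover
    qed
    fix n a b t assume t: "0 \<le> (t::real)"
    let ?w = "comb B x n a b"
    show "P t n ?w = \<zero>\<^bsub>Sp t n\<^esub> \<longleftrightarrow>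
        (\<forall>p\<in>copies (B n). a p \<noteq> 0 \<longrightarrow> snd (fst p) \<le> ereal t) \<and>
        (\<forall>p\<in>copies (B (Suc n)). b p \<noteq> 0 \<longrightarrow> fst (fst p) \<le> ereal t)"
      unfolding P_eq_zero_iff[OF t]
    proof (intro iffI conjI ballI impI)
      assume le: "d n ?w \<le> ereal t"
      fix p assume p: "p \<in> copies (B n)" "a p \<noteq> 0"
      have "d n (x n p) \<le> d n ?w" unfolding comb_T by (rule T(5)) (use p xT y in auto)
      then show "snd (fst p) \<le> ereal t" using le dx p by simp
    next
      assume le: "d n ?w \<le> ereal t"
      fix p assume p: "p \<in> copies (B (Suc n))" "b p \<noteq> 0"
      have "d n (D (Suc n) (x (Suc n) p)) \<le> d n ?w" unfolding comb_T by (rule T(6)) (use p xT y in auto)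
      then show "fst (fst p) \<le> ereal t" using le dDx'[OF p(1)] by simp
    next
      assume *: "(\<forall>p\<in>copies (B n). a p \<noteq> 0 \<longrightarrow> snd (fst p) \<le> ereal t) \<and>
        (\<forall>p\<in>copies (B (Suc n)). b p \<noteq> 0 \<longrightarrow> fst (fst p) \<le> ereal t)"
      \<comment> \<open>This direction is the ultrametric inequality alone.\<close>
      have 0: "d n 0 \<le> ereal t" using t d_zero by simp
      show "d n ?w \<le> ereal t" unfolding comb_def
        by (intro fs.ultra_seminorm_add[OF d_ultra] fs.ultra_seminorm_sum[OF d_ultra finite_copies 0])
          (use * dx dDx' in \<open>auto\<close>)
    qed
  qed
  ultimately show thesis by (rule that)
qed

end

section \<open>Realizations and decompositions into bars\<close>

lemma vs_r_zero: "vs (V :: ('k::field, 'v) module) \<Longrightarrow> x \<in> carrier V \<Longrightarrow> x \<oplus>\<^bsub>V\<^esub> \<zero>\<^bsub>V\<^esub> = x"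
proof -
  assume "vs V" and x: "x \<in> carrier V"
  then interpret V: vectorspace class_ring V by simp
  show "x \<oplus>\<^bsub>V\<^esub> \<zero>\<^bsub>V\<^esub> = x" using x by simp
qed

lemma bar_carrierI:
  assumes "\<And>n. f n \<in> extensional (copies (B n))"
    "\<And>n p. p \<in> copies (B n) \<Longrightarrow> \<not> alive n (fst p) r k \<Longrightarrow> f n p = 0"
  shows "f \<in> bar_carrier B r k"
  using assms unfolding bar_carrier_def by blast

lemma bar_carrierD:
  assumes "f \<in> bar_carrier B r k"
  shows bar_carrier_ext: "f n \<in> extensional (copies (B n))"
    and bar_carrier_dead: "p \<in> copies (B n) \<Longrightarrow> \<not> alive n (fst p) r k \<Longrightarrow> f n p = 0"
  using assms unfolding bar_carrier_def by blast+

lemma bar_carrier_eqI: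
  assumes "f \<in> bar_carrier B r k" "g \<in> bar_carrier B r' k'"
    "\<And>n p. p \<in> copies (B n) \<Longrightarrow> f n p = g n p"
  shows "f = g"
proof (intro ext)
  fix n p
  show "f n p = g n p"
    using assms(3) extensional_arb[OF bar_carrier_ext[OF assms(1)], of p n]
      extensional_arb[OF bar_carrier_ext[OF assms(2)], of p n]
    by (cases "p \<in> copies (B n)") simp_all
qed

lemma is_tBar_alt: "is_tBar X B \<longleftrightarrow> tagged_bars B \<and> X \<cong>\<^sub>p bar_sum B"
  unfolding is_tBar_def tagged_bars_def by blast

context factored
begin

text \<open>The difference is a combination whose nonzero coefficients belong to generators and
  boundaries that are dead at \<open>t\<close>, so the kernel condition applies to it.\<close>

lemma P_comb_cong:
  assumes x: "realizes B x" and t: "0 \<le> t"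
    and a: "\<And>p. p \<in> copies (B n) \<Longrightarrow> ereal t < snd (fst p) \<Longrightarrow> a p = a' p"
    and b: "\<And>p. p \<in> copies (B (Suc n)) \<Longrightarrow> ereal t < fst (fst p) \<Longrightarrow> b p = b' p"
  shows "P t n (comb B x n a b) = P t n (comb B x n a' b')"
proof -
  have "comb B x n a b = comb B x n a' b' + comb B x n (\<lambda>p. a p - a' p) (\<lambda>p. b p - b' p)"
    unfolding comb_add[symmetric] by simp
  moreover have "P t n (comb B x n (\<lambda>p. a p - a' p) (\<lambda>p. b p - b' p)) = \<zero>\<^bsub>Sp t n\<^esub>"
    unfolding realizes_kernel[OF x t]
  proof (intro conjI ballI impI)
    show "snd (fst p) \<le> ereal t" if "p \<in> copies (B n)" "a p - a' p \<noteq> 0" for p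
      using a[OF that(1)] that(2) by (cases "ereal t < snd (fst p)") simp_all
    show "fst (fst p) \<le> ereal t" if "p \<in> copies (B (Suc n))" "b p - b' p \<noteq> 0" for p
      using b[OF that(1)] that(2) by (cases "ereal t < fst (fst p)") simp_all
  qed
  ultimately show ?thesis using P_add[OF t] vs_r_zero[OF vs_Sp[OF t] P_closed[OF t]] by simp
qed

text \<open>A realization gives coordinates on every \<open>X^t\<close> at once. The kernel
  condition yields injectivity on the coefficients alive at \<open>t\<close>; the spanning condition
  and the surjective internal maps yield surjectivity.\<close>

lemma is_tBar_if_realizes:
  assumes B: "tagged_bars B" and x: "realizes B x"
  shows "is_tBar X B"
proof -
  define F where "F t k f = P t k (comb B x k (f k) (f (Suc k)))"
    for t k and f :: "nat \<Rightarrow> tagged_interval \<times> nat \<Rightarrow> 'k"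
  note simps = bar_sum_carrier[OF B] bar_sum_zero[OF B] bar_sum_add[OF B] bar_sum_smult[OF B] bar_sum_bdry[OF B]
  have lin: "linear_map class_ring (space_at (val (bar_sum B) t) n) (Sp t n) (F t n)" if t: "0 \<le> t" for t n
  proof (rule linear_mapI[OF bar_sum_vs[OF B] vs_Sp[OF t]], unfold simps)
    fix f g :: "nat \<Rightarrow> tagged_interval \<times> nat \<Rightarrow> 'k" and c
    show "F t n f \<in> carrier (Sp t n)" unfolding F_def by (rule P_closed[OF t])
    show "F t n (\<lambda>n. \<lambda>p\<in>copies (B n). f n p + g n p) = F t n f \<oplus>\<^bsub>Sp t n\<^esub> F t n g"
      unfolding F_def P_add[OF t, symmetric] comb_add[symmetric]
      by (intro arg_cong[where f = "P t n"] comb_cong) auto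
    show "F t n (\<lambda>n. \<lambda>p\<in>copies (B n). c * f n p) = c \<odot>\<^bsub>Sp t n\<^esub> F t n f"
      unfolding F_def P_scale[OF t, symmetric] comb_scale[symmetric]
      by (intro arg_cong[where f = "P t n"] comb_cong) auto
  qed
  have bij: "bij_betw (F t n) (bar_carrier B t n) (carrier (Sp t n))" if t: "0 \<le> t" for t n
    unfolding bij_betw_def
  proof
    have "f = (\<lambda>n. \<lambda>p\<in>copies (B n). 0)" if f: "f \<in> bar_carrier B t n" and 0: "F t n f = \<zero>\<^bsub>Sp t n\<^esub>" for f
    proof (rule bar_carrier_eqI[OF f])
      show "(\<lambda>n. \<lambda>p\<in>copies (B n). 0 :: 'k) \<in> bar_carrier B t n" by (rule bar_carrierI) auto
      fix m p assume p: "p \<in> copies (B m)"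
      have "f m p = 0" if "alive m (fst p) t n"
      proof (rule ccontr)
        assume nz: "f m p \<noteq> 0"
        note 0 = 0[unfolded F_def realizes_kernel[OF x t]]
        from that consider "n = m" "ereal t < snd (fst p)" | "Suc n = m" "ereal t < fst (fst p)"
          unfolding alive_def by blast
        then show False
        proof cases
          case 1
          then show False using conjunct1[OF 0] p nz by (auto simp: not_le[symmetric])
        next
          case 2
          then show False using conjunct2[OF 0] p nz by (auto simp: not_le[symmetric])
        qed
      qed
      then show "f m p = (\<lambda>p\<in>copies (B m). 0) p" using bar_carrier_dead[OF f p] p by auto
    qed
    then show "inj_on (F t n) (bar_carrier B t n)"
      using linear_map_inj_on[OF lin[OF t, of n]] unfolding simps by blast
    show "F t n ` bar_carrier B t n = carrier (Sp t n)"
    proof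
      show "F t n ` bar_carrier B t n \<subseteq> carrier (Sp t n)" unfolding F_def using P_closed[OF t] by blast
      show "carrier (Sp t n) \<subseteq> F t n ` bar_carrier B t n"
      proof
        fix v assume "v \<in> carrier (Sp t n)"
        then obtain u where u: "u \<in> U n" "P t n u = v" using P_surj[OF t] by blast
        obtain a b where ab: "u = comb B x n a b" using realizes_span[OF x u(1)] by blast
        \<comment> \<open>Coefficients of dead bars are set to 0 to land in the carrier, which
          \<open>P_comb_cong\<close> permits.\<close>
        define f where "f = (\<lambda>m. \<lambda>p\<in>copies (B m). if \<not> alive m (fst p) t n then 0 else if m = n then a p else b p)"
        have "F t n f = v"
          unfolding F_def u(2)[symmetric] ab by (rule P_comb_cong[OF x t]) (auto simp: f_def alive_def)
        moreover have "f \<in> bar_carrier B t n" by (rule bar_carrierI) (auto simp: f_def)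
        ultimately show "v \<in> F t n ` bar_carrier B t n" by blast
      qed
    qed
  qed
  have "X \<cong>\<^sub>p bar_sum B"
  proof (rule param_isomorphicI[where F = F, OF lin], assumption, unfold simps)
    show "bij_betw (F t n) (bar_carrier B t n) (carrier (Sp t n))" if "0 \<le> t" for t n by (rule bij[OF that])
  next
    fix t n and f :: "nat \<Rightarrow> tagged_interval \<times> nat \<Rightarrow> 'k"
    assume t: "0 \<le> (t::real)" and f: "f \<in> bar_carrier B t (Suc n)"
    show "(\<lambda>m. \<lambda>p\<in>copies (B m). if Suc n = m \<and> ereal t < fst (fst p) then f m p else 0) \<in> bar_carrier B t n"
      by (rule bar_carrierI) (auto simp: alive_def)
    \<comment> \<open>The differential of the bar sum reinterprets generator coefficients of degree
      \<open>n + 1\<close> as boundary coefficients in degree \<open>n\<close>, exactly as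
      \<open>D_comb\<close> does.\<close>
    have "F t n (\<lambda>m. \<lambda>p\<in>copies (B m). if Suc n = m \<and> ereal t < fst (fst p) then f m p else 0) =
        P t n (comb B x n (\<lambda>_. 0) (f (Suc n)))"
      unfolding F_def by (rule P_comb_cong[OF x t]) auto
    also have "\<dots> = bdry (val X t) (Suc n) (F t (Suc n) f)"
      unfolding F_def P_D[OF t, symmetric] D_comb ..
    finally show "F t n (\<lambda>m. \<lambda>p\<in>copies (B m). if Suc n = m \<and> ereal t < fst (fst p) then f m p else 0) =
        bdry (val X t) (Suc n) (F t (Suc n) f)" .
  next
    fix s t n and f :: "nat \<Rightarrow> tagged_interval \<times> nat \<Rightarrow> 'k"
    assume st: "0 \<le> (s::real)" "s \<le> t" and f: "f \<in> bar_carrier B s n"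
    have t: "0 \<le> t" using st by simp
    note tr = bar_sum_trans[OF B st(2) f]
    show "trans_map (bar_sum B) s t n f \<in> bar_carrier B t n"
      unfolding tr by (rule bar_carrierI) auto
    have "F t n (trans_map (bar_sum B) s t n f) = P t n (comb B x n (f n) (f (Suc n)))"
      unfolding F_def tr by (rule P_comb_cong[OF x t]) (auto simp: alive_def)
    also have "\<dots> = trans_map X s t n (F s n f)" unfolding F_def using P_trans[OF st] by simp
    finally show "F t n (trans_map (bar_sum B) s t n f) = trans_map X s t n (F s n f)" .
  qed
  then show ?thesis using B is_tBar_alt by blast
qed

text \<open>The generators are the unit vectors of the bars at time 0, carried to \<open>X\<close>
  by the isomorphism. Naturality of \<open>\<phi>\<close> along the maps out of time 0 then
  transfers the kernels.\<close>

lemma realizes_if_is_tBar: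
  assumes "is_tBar X B"
  obtains x where "realizes B x"
proof -
  have B: "tagged_bars B" and iso: "X \<cong>\<^sub>p bar_sum B" using assms is_tBar_alt by blast+
  obtain \<phi> \<psi> where \<phi>: "param_morphism X (bar_sum B) \<phi>" and \<psi>: "param_morphism (bar_sum B) X \<psi>"
    and \<psi>\<phi>': "\<forall>t\<ge>0. \<forall>n. \<forall>v\<in>carrier (Sp t n). \<psi> t n (\<phi> t n v) = v"
    and \<phi>\<psi>': "\<forall>t\<ge>0. \<forall>n. \<forall>y\<in>carrier (space_at (val (bar_sum B) t) n). \<phi> t n (\<psi> t n y) = y"
    using iso unfolding param_isomorphic_def by auto
  have \<psi>\<phi>: "\<psi> t n (\<phi> t n v) = v" if "0 \<le> t" "v \<in> carrier (Sp t n)" for t n v using \<psi>\<phi>' that by simp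
  have \<phi>\<psi>: "\<phi> t n (\<psi> t n y) = y" if "0 \<le> t" "y \<in> bar_carrier B t n" for t n y
    using \<phi>\<psi>' that by (simp add: bar_sum_carrier[OF B])
  have \<phi>_lin: "linear_map class_ring (Sp t n) (space_at (val (bar_sum B) t) n) (\<phi> t n)"
   and \<psi>_lin: "linear_map class_ring (space_at (val (bar_sum B) t) n) (Sp t n) (\<psi> t n)"
   and \<phi>_bdry: "v \<in> carrier (Sp t (Suc n)) \<Longrightarrow>
      \<phi> t n (bdry (val X t) (Suc n) v) = bdry (val (bar_sum B) t) (Suc n) (\<phi> t (Suc n) v)"
    if "0 \<le> t" for t n v
    using \<phi> \<psi> that unfolding param_morphism_def chain_map_def by simp_all
  have \<phi>_trans: "\<phi> t n (trans_map X 0 t n v) = trans_map (bar_sum B) 0 t n (\<phi> 0 n v)"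
    if "0 \<le> t" "v \<in> carrier (Sp 0 n)" for t n v
    using \<phi> that unfolding param_morphism_def by simp
  have \<phi>_in: "\<phi> t n v \<in> bar_carrier B t n" if "0 \<le> t" "v \<in> carrier (Sp t n)" for t n v
    using linear_map_closed[OF \<phi>_lin[OF that(1)] that(2)] by (simp add: bar_sum_carrier[OF B])
  \<comment> \<open>Bars have positive length, so each of these vectors belongs to the bar sum at
    time 0.\<close>
  define \<delta> :: "nat \<Rightarrow> tagged_interval \<times> nat \<Rightarrow> nat \<Rightarrow> tagged_interval \<times> nat \<Rightarrow> 'k"
    where "\<delta> n p = (\<lambda>m. \<lambda>q\<in>copies (B m). if m = n \<and> q = p then 1 else 0)" for n p
  have \<delta>: "\<delta> n p \<in> bar_carrier B 0 n" for n p
    by (rule bar_carrierI)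
      (use tagged_bars_copies(1)[OF B] in \<open>auto simp: \<delta>_def alive_def zero_ereal_def[symmetric]\<close>)
  define x where "x n p = cd n (\<psi> 0 n (\<delta> n p))" for n p
  have \<psi>\<delta>: "\<psi> 0 n (\<delta> n p) \<in> carrier (Sp 0 n)" for n p
    using linear_map_closed[OF \<psi>_lin[of 0 n]] \<delta> by (simp add: bar_sum_carrier[OF B])
  have x_in: "x n p \<in> U n" for n p unfolding x_def using cd_in[OF \<psi>\<delta>] .
  define \<Phi> where "\<Phi> n u = \<phi> 0 n (E n u)" for n u
  have \<Phi>_in: "\<Phi> n u \<in> bar_carrier B 0 n" for n u unfolding \<Phi>_def by (rule \<phi>_in) auto
  have \<Phi>_x: "\<Phi> n (x n p) = \<delta> n p" for n p
    unfolding \<Phi>_def x_def E_cd[OF \<psi>\<delta>] by (rule \<phi>\<psi>[OF _ \<delta>]) simp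
  have \<Phi>_D: "\<Phi> n (D (Suc n) u) m q =
      (if m = Suc n \<and> 0 < fst (fst q) then \<Phi> (Suc n) u m q else 0)" if "q \<in> copies (B m)" for n u m q
    unfolding \<Phi>_def E_D using that \<phi>_bdry[of 0 "E (Suc n) u" n]
    by (auto simp: bar_sum_bdry[OF B] zero_ereal_def[symmetric])
  have \<Phi>_add: "\<Phi> n (u + v) m q = \<Phi> n u m q + \<Phi> n v m q" if "q \<in> copies (B m)" for n u v m q
    unfolding \<Phi>_def E_add using linear_map_add[OF \<phi>_lin[of 0 n] E_closed E_closed] that
    by (simp add: bar_sum_add[OF B])
  have \<Phi>_scale: "\<Phi> n (fun_scale c u) m q = c * \<Phi> n u m q" if "q \<in> copies (B m)" for n c u m q
    unfolding \<Phi>_def E_scale using linear_map_smult[OF \<phi>_lin[of 0 n] E_closed] that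
    by (simp add: bar_sum_smult[OF B])
  have \<Phi>_sum: "\<Phi> n (\<Sum>p\<in>A. fun_scale (a p) (w p)) m q = (\<Sum>p\<in>A. a p * \<Phi> n (w p) m q)"
    if q: "q \<in> copies (B m)" and "finite A" for n m q a w and A :: "(tagged_interval \<times> nat) set"
    using that(2)
  proof (induction A rule: finite_induct)
    case empty
    then show ?case using \<Phi>_scale[OF q, of n 0 0]
      by (simp only: fs.scale_zero_left sum.empty mult_zero_left)
  next
    case (insert p A)
    then show ?case by (simp only: sum.insert \<Phi>_add[OF q] \<Phi>_scale[OF q] not_False_eq_True)
  qed
  \<comment> \<open>The coordinates return all of \<open>a\<close>, but \<open>b\<close> only on
    bars with positive tag: a bar with tag 0 is a sphere from the start and its generator has
    boundary 0.\<close>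
  have \<Phi>_comb: "\<Phi> n (comb B x n a b) m q =
      (if m = n then a q else if m = Suc n \<and> 0 < fst (fst q) then b q else 0)"
    if q: "q \<in> copies (B m)" for n a b m q
  proof -
    have 1: "(\<Sum>p\<in>copies (B n). a p * \<Phi> n (x n p) m q) = (if m = n then a q else 0)"
    proof -
      have "(\<Sum>p\<in>copies (B n). a p * \<Phi> n (x n p) m q) =
          (\<Sum>p\<in>copies (B n). if q = p then (if m = n then a p else 0) else 0)"
        unfolding \<Phi>_x using q by (intro sum.cong) (auto simp: \<delta>_def)
      then show ?thesis using q by (cases "m = n") (simp_all add: finite_copies)
    qed
    have 2: "(\<Sum>p\<in>copies (B (Suc n)). b p * \<Phi> n (D (Suc n) (x (Suc n) p)) m q) =
        (if m = Suc n \<and> 0 < fst (fst q) then b q else 0)"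
    proof -
      have "(\<Sum>p\<in>copies (B (Suc n)). b p * \<Phi> n (D (Suc n) (x (Suc n) p)) m q) =
          (\<Sum>p\<in>copies (B (Suc n)). if q = p then (if m = Suc n \<and> 0 < fst (fst q) then b p else 0) else 0)"
        unfolding \<Phi>_D[OF q] \<Phi>_x using q by (intro sum.cong) (auto simp: \<delta>_def)
      then show ?thesis using q by (cases "m = Suc n") (simp_all add: finite_copies)
    qed
    show ?thesis unfolding comb_def \<Phi>_add[OF q] \<Phi>_sum[OF q finite_copies] 1 2 by simp
  qed
  have \<Phi>_inj: "u = v" if "u \<in> U n" "v \<in> U n" "\<Phi> n u = \<Phi> n v" for n u v
  proof (rule E_cong[OF that(1,2)])
    have "E n u = \<psi> 0 n (\<Phi> n u)" "E n v = \<psi> 0 n (\<Phi> n v)"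
      unfolding \<Phi>_def by (rule \<psi>\<phi>[OF order_refl E_closed, symmetric])+
    then show "E n u = E n v" using that(3) by simp
  qed
  have comb_U: "comb B x n a b \<in> U n" for n a b
    unfolding comb_def using x_in D_in
    by (intro fs.subspace_add fs.subspace_sum fs.subspace_scale U_subspace) auto
  have span: "\<exists>a b. v = comb B x n a b" if v: "v \<in> U n" for n v
  proof (intro exI)
    show "v = comb B x n (\<Phi> n v n) (\<Phi> n v (Suc n))"
    proof (rule \<Phi>_inj[OF v comb_U], rule bar_carrier_eqI[OF \<Phi>_in \<Phi>_in])
      fix m q assume q: "q \<in> copies (B m)"
      show "\<Phi> n v m q = \<Phi> n (comb B x n (\<Phi> n v n) (\<Phi> n v (Suc n))) m q"
        unfolding \<Phi>_comb[OF q] using bar_carrier_dead[OF \<Phi>_in[of n v] q]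
        by (auto simp: alive_def zero_ereal_def[symmetric])
    qed
  qed
  have kernel: "P t n (comb B x n a b) = \<zero>\<^bsub>Sp t n\<^esub> \<longleftrightarrow>
        (\<forall>p\<in>copies (B n). a p \<noteq> 0 \<longrightarrow> snd (fst p) \<le> ereal t) \<and>
        (\<forall>p\<in>copies (B (Suc n)). b p \<noteq> 0 \<longrightarrow> fst (fst p) \<le> ereal t)" if t: "0 \<le> t" for t n a b
  proof -
    let ?w = "comb B x n a b"
    have contrapos: "(ereal t < u \<longrightarrow> c = 0) \<longleftrightarrow> (c \<noteq> 0 \<longrightarrow> u \<le> ereal t)" for u and c :: 'k
      by (auto simp: not_less[symmetric])
    have "P t n ?w = \<zero>\<^bsub>Sp t n\<^esub> \<longleftrightarrow> \<phi> t n (P t n ?w) = \<zero>\<^bsub>space_at (val (bar_sum B) t) n\<^esub>"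
      (is "?l \<longleftrightarrow> ?r")
    proof
      show "?l \<Longrightarrow> ?r" using linear_map_zero[OF \<phi>_lin[OF t, of n]] by simp
      show "?r \<Longrightarrow> ?l" using \<psi>\<phi>[OF t P_closed[OF t], of n ?w] linear_map_zero[OF \<psi>_lin[OF t, of n]] by simp
    qed
    also have "\<phi> t n (P t n ?w) = trans_map (bar_sum B) 0 t n (\<Phi> n ?w)"
      unfolding P_def \<Phi>_def by (rule \<phi>_trans[OF t E_closed])
    also have "\<dots> = (\<lambda>m. \<lambda>q\<in>copies (B m). if alive m (fst q) t n then \<Phi> n ?w m q else 0)"
      by (rule bar_sum_trans[OF B t \<Phi>_in])
    also have "\<dots> = \<zero>\<^bsub>space_at (val (bar_sum B) t) n\<^esub> \<longleftrightarrow>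
        (\<forall>m. \<forall>q\<in>copies (B m). alive m (fst q) t n \<longrightarrow> \<Phi> n ?w m q = 0)" (is "?l \<longleftrightarrow> ?r")
    proof
      assume l: ?l
      show ?r
      proof (intro allI ballI impI)
        fix m q assume "q \<in> copies (B m)" "alive m (fst q) t n"
        then show "\<Phi> n ?w m q = 0" using fun_cong[OF fun_cong[OF l, of m], of q]
          by (simp add: bar_sum_zero[OF B])
      qed
    next
      assume ?r
      then show ?l unfolding bar_sum_zero[OF B] by (intro ext) (simp add: restrict_def)
    qed
    also have "\<dots> \<longleftrightarrow> (\<forall>p\<in>copies (B n). ereal t < snd (fst p) \<longrightarrow> a p = 0) \<and>
        (\<forall>p\<in>copies (B (Suc n)). ereal t < fst (fst p) \<longrightarrow> b p = 0)" (is "?l \<longleftrightarrow> ?r")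
    proof
      assume l: ?l
      have "a p = 0" if "p \<in> copies (B n)" "ereal t < snd (fst p)" for p
      proof -
        have "alive n (fst p) t n" using that(2) by (simp add: alive_def)
        then have "\<Phi> n ?w n p = 0" using l that(1) by blast
        then show ?thesis unfolding \<Phi>_comb[OF that(1)] by simp
      qed
      moreover have "b p = 0" if p: "p \<in> copies (B (Suc n))" "ereal t < fst (fst p)" for p
      proof -
        \<comment> \<open>The tag exceeds \<open>t \<ge> 0\<close>, so it is positive and
          \<open>\<Phi>_comb\<close> sees the coefficient.\<close>
        have "0 < fst (fst p)" using p(2) t by (metis ereal_less_eq(5) order_le_less_trans)
        moreover have "\<Phi> n ?w (Suc n) p = 0" using l p unfolding alive_def by blast
        ultimately show ?thesis unfolding \<Phi>_comb[OF p(1)] by simp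
      qed
      ultimately show ?r by blast
    next
      assume ?r
      then show ?l by (auto simp: \<Phi>_comb alive_def)
    qed
    finally show ?thesis unfolding contrapos .
  qed
  have "realizes B x" unfolding realizes_def using x_in span kernel by simp
  then show thesis by (rule that)
qed

end

section \<open>Counting bars by linear independence\<close>

context linear_space
begin

text \<open>Bars are counted with multiplicity while \<open>independent\<close> concerns a set of
  vectors, so injectivity is part of the claim: a repeated vector gives the relation with
  coefficients 1 and -1.\<close>

lemma independent_family:
  fixes w :: "'i \<Rightarrow> 'b"
  assumes "finite I" and ind: "\<And>c. (\<Sum>i\<in>I. c i *s w i) = 0 \<Longrightarrow> \<forall>i\<in>I. c i = 0"
  shows "inj_on w I" "independent (w ` I)"
proof -
  show inj: "inj_on w I"
  proof (rule inj_onI, rule ccontr)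
    fix i j assume ij: "i \<in> I" "j \<in> I" "w i = w j" "i \<noteq> j"
    define c :: "'i \<Rightarrow> 'k" where "c l = (if l = i then 1 else if l = j then - 1 else 0)" for l
    have "(\<Sum>l\<in>I. c l *s w l) = (\<Sum>l\<in>{i, j}. c l *s w l)"
      using assms(1) ij by (intro sum.mono_neutral_right) (auto simp: c_def)
    also have "\<dots> = 0" using ij by (simp add: c_def)
    finally show False using ind[of c] ij by (auto simp: c_def)
  qed
  show "independent (w ` I)"
  proof (rule independent_if_scalars_zero)
    show "finite (w ` I)" using assms(1) by simp
    fix f v assume "(\<Sum>v\<in>w ` I. f v *s v) = 0" and v: "v \<in> w ` I"
    then have "(\<Sum>i\<in>I. f (w i) *s w i) = 0" by (simp add: sum.reindex[OF inj])
    then show "f v = 0" using ind[of "\<lambda>i. f (w i)"] v by auto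
  qed
qed

lemma card_le_if_independent_family:
  assumes "finite I" "\<And>c. (\<Sum>i\<in>I. c i *s w i) = 0 \<Longrightarrow> \<forall>i\<in>I. c i = 0"
    and J: "finite J" "\<And>i. i \<in> I \<Longrightarrow> w i \<in> span (z ` J)"
  shows "card I \<le> card J"
proof -
  note ind = independent_family[OF assms(1,2)]
  have "w ` I \<subseteq> span (z ` J)" using J(2) by blast
  then have "card (w ` I) \<le> card (z ` J)"
    using independent_span_bound[OF finite_imageI[OF J(1)] ind(2)] by simp
  then show ?thesis using card_image[OF ind(1)] card_image_le[OF J(1), of z] by simp
qed

end

context factored
begin

text \<open>At time 0 no generator is dead, and a boundary only if its tag is 0, so the kernel
  condition at 0 amounts to linear independence.\<close>

lemma realizes_vanish:
  assumes "tagged_bars B" "realizes B x" "comb B x n a b = 0"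
  shows "p \<in> copies (B n) \<Longrightarrow> a p = 0"
    and "p \<in> copies (B (Suc n)) \<Longrightarrow> 0 < fst (fst p) \<Longrightarrow> b p = 0"
proof -
  have *: "(\<forall>p\<in>copies (B n). a p \<noteq> 0 \<longrightarrow> snd (fst p) \<le> ereal 0) \<and>
      (\<forall>p\<in>copies (B (Suc n)). b p \<noteq> 0 \<longrightarrow> fst (fst p) \<le> ereal 0)"
    using realizes_kernel[OF assms(2), of 0 n a b] assms(3) P_zero[of 0] by simp
  show "a p = 0" if p: "p \<in> copies (B n)"
  proof (rule ccontr)
    assume "a p \<noteq> 0"
    then have "snd (fst p) \<le> 0" using * p by (auto simp: zero_ereal_def)
    then show False using tagged_bars_copies(1)[OF assms(1) p] by simp
  qed
  show "b p = 0" if p: "p \<in> copies (B (Suc n))" "0 < fst (fst p)"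
  proof (rule ccontr)
    assume "b p \<noteq> 0"
    then have "fst (fst p) \<le> 0" using * p by (auto simp: zero_ereal_def)
    then show False using p(2) by simp
  qed
qed

text \<open>The kernel condition at time 0, where \<open>P\<close> is injective on
  \<open>U n\<close>. Together with \<open>realizes_vanish\<close> it identifies the nonzero
  boundaries as those of the bars with positive tag.\<close>

lemma D_bar_zero:
  assumes "realizes B x" "p \<in> copies (B (Suc n))" "fst (fst p) \<le> 0"
  shows "D (Suc n) (x (Suc n) p) = 0"
proof -
  have "P 0 n (D (Suc n) (x (Suc n) p)) = \<zero>\<^bsub>Sp 0 n\<^esub>"
    unfolding comb_single_D[where B = B and x = x, OF assms(2), symmetric] realizes_kernel[OF assms(1) order_refl]
    using assms(3) by (auto simp: zero_ereal_def)
  then have "E n (D (Suc n) (x (Suc n) p)) = E n 0" by (simp add: P_0 E_zero)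
  then show ?thesis using E_cong D_in U_subspace fs.subspace_0 by blast
qed

text \<open>Expanding an element of one realization in another one only involves bars that die no later,
  both for the element itself and for its boundary.\<close>

lemma realizes_expand:
  assumes B: "tagged_bars B" and x: "realizes B x" and x': "realizes B' x'" and B': "tagged_bars B'"
    and p: "p \<in> copies (B n)"
  obtains a b where "x n p = comb B' x' n a b"
    "\<And>q. q \<in> copies (B' n) \<Longrightarrow> a q \<noteq> 0 \<Longrightarrow> fst (fst q) \<le> fst (fst p) \<and> snd (fst q) \<le> snd (fst p)"
proof -
  obtain a b where ab: "x n p = comb B' x' n a b" using realizes_span[OF x' realizes_in[OF x p]] by blast
  note t = tagged_bars_copies[OF B p]
  have "snd (fst q) \<le> snd (fst p)" if q: "q \<in> copies (B' n)" "a q \<noteq> 0" for q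
  proof (cases "snd (fst p)")
    case (real r)
    then have r: "0 \<le> r" using t(1) by simp
    have "P r n (x n p) = \<zero>\<^bsub>Sp r n\<^esub>"
      unfolding comb_single[where B = B and x = x, OF p, symmetric] realizes_kernel[OF x r] using real by auto
    then show ?thesis using q real unfolding ab realizes_kernel[OF x' r] by auto
  qed (use t in auto)
  moreover have "fst (fst q) \<le> fst (fst p)" if q: "q \<in> copies (B' n)" "a q \<noteq> 0" for q
  proof (cases n)
    case 0
    then show ?thesis using t(2) tagged_bars_copies(4)[OF B' q(1)] by simp
  next
    case (Suc m)
    note p = p[unfolded Suc] and ab = ab[unfolded Suc] and q = q[unfolded Suc]
    show ?thesis
    proof (cases "fst (fst p)")
      case (real r)
      then have r: "0 \<le> r" using t(2) by simp
      \<comment> \<open>The boundary of the generator is dead at the tag \<open>r\<close>, and by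
        \<open>D_comb\<close> its expansion has the same coefficients \<open>a\<close>, now tested
        against tags.\<close>
      have "P r m (D (Suc m) (x (Suc m) p)) = \<zero>\<^bsub>Sp r m\<^esub>"
        unfolding comb_single_D[where B = B and x = x, OF p, symmetric] realizes_kernel[OF x r] using real by auto
      then show ?thesis using q real unfolding ab D_comb realizes_kernel[OF x' r] by auto
    qed (use t in auto)
  qed
  ultimately show thesis by (intro that[OF ab] conjI)
qed

text \<open>A generator whose bar satisfies \<open>c\<close> expands into generators of
  \<open>B'\<close> that satisfy \<open>c\<close> as well, plus boundaries about which nothing is
  known. Adding all nonzero boundaries of \<open>B'\<close> gives a spanning family; on the other
  side those of \<open>B\<close> join the selected generators without losing independence and lie in
  the same span.\<close>

lemma card_bars_le:
  assumes B: "tagged_bars B" and x: "realizes B x" and B': "tagged_bars B'" and x': "realizes B' x'"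
    and down: "\<And>I I'. c I \<Longrightarrow> fst I' \<le> fst I \<Longrightarrow> snd I' \<le> snd I \<Longrightarrow> c I'"
  shows "card {p \<in> copies (B n). c (fst p)} + card {p \<in> copies (B (Suc n)). 0 < fst (fst p)}
    \<le> card {p \<in> copies (B' n). c (fst p)} + card {p \<in> copies (B' (Suc n)). 0 < fst (fst p)}"
proof -
  define A M A' M' where "A = {p \<in> copies (B n). c (fst p)}"
    and "M = {p \<in> copies (B (Suc n)). 0 < fst (fst p)}"
    and "A' = {p \<in> copies (B' n). c (fst p)}"
    and "M' = {p \<in> copies (B' (Suc n)). 0 < fst (fst p)}"
  have fin: "finite A" "finite M" "finite A'" "finite M'"
    unfolding A_def M_def A'_def M'_def by (simp_all add: finite_copies)
  define w where "w = case_sum (x n) (\<lambda>p. D (Suc n) (x (Suc n) p))"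
  define w' where "w' = case_sum (x' n) (\<lambda>p. D (Suc n) (x' (Suc n) p))"
  have span_M: "D (Suc n) (x' (Suc n) q) \<in> fs.span (w' ` (A' <+> M'))" if "q \<in> copies (B' (Suc n))" for q
  proof (cases "0 < fst (fst q)")
    case True
    then have "w' (Inr q) \<in> w' ` (A' <+> M')" using that unfolding M'_def by blast
    from fs.span_base[OF this] show ?thesis by (simp add: w'_def)
  next
    case False
    then show ?thesis using D_bar_zero[OF x' that] fs.span_zero by (simp)
  qed
  have ind: "\<forall>i\<in>A <+> M. f i = 0" if sum: "(\<Sum>i\<in>A <+> M. fun_scale (f i) (w i)) = 0" for f
  proof -
    define a where "a p = (if p \<in> A then f (Inl p) else 0)" for p
    define b where "b p = (if p \<in> M then f (Inr p) else 0)" for p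
    have 1: "(\<Sum>p\<in>copies (B n). fun_scale (a p) (x n p)) = (\<Sum>p\<in>A. fun_scale (f (Inl p)) (x n p))"
      by (rule sum.mono_neutral_cong_right) (auto simp: a_def A_def finite_copies)
    have 2: "(\<Sum>p\<in>copies (B (Suc n)). fun_scale (b p) (D (Suc n) (x (Suc n) p))) =
        (\<Sum>p\<in>M. fun_scale (f (Inr p)) (D (Suc n) (x (Suc n) p)))"
      by (rule sum.mono_neutral_cong_right) (auto simp: b_def M_def finite_copies)
    have 0: "comb B x n a b = 0"
      using sum unfolding comb_def 1 2 by (simp add: sum.Plus fin w_def)
    show ?thesis
    proof
      fix i assume "i \<in> A <+> M"
      then show "f i = 0"
      proof (elim PlusE)
        fix p assume p: "p \<in> A" "i = Inl p"
        then have "a p = 0" using realizes_vanish(1)[OF B x 0] unfolding A_def by blast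
        then show ?thesis using p by (simp add: a_def)
      next
        fix p assume p: "p \<in> M" "i = Inr p"
        then have "b p = 0" using realizes_vanish(2)[OF B x 0] unfolding M_def by blast
        then show ?thesis using p by (simp add: b_def)
      qed
    qed
  qed
  have "w i \<in> fs.span (w' ` (A' <+> M'))" if "i \<in> A <+> M" for i
    using that
  proof (elim PlusE)
    fix p assume p: "p \<in> A" "i = Inl p"
    then have pn: "p \<in> copies (B n)" "c (fst p)" unfolding A_def by auto
    obtain a b where ab: "x n p = comb B' x' n a b"
      and le: "\<And>q. q \<in> copies (B' n) \<Longrightarrow> a q \<noteq> 0 \<Longrightarrow> fst (fst q) \<le> fst (fst p) \<and> snd (fst q) \<le> snd (fst p)"
      by (fact realizes_expand[OF B x x' B' pn(1)])
    have *: "fun_scale (a q) (x' n q) \<in> fs.span (w' ` (A' <+> M'))" if q: "q \<in> copies (B' n)" for q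
    proof (cases "a q = 0")
      case True
      then show ?thesis using fs.span_zero by (simp only: fs.scale_zero_left)
    next
      case False
      then have "q \<in> A'" using le[OF q] down[OF pn(2)] q unfolding A'_def by blast
      then have "w' (Inl q) \<in> w' ` (A' <+> M')" by blast
      then show ?thesis unfolding w'_def by (intro fs.span_scale fs.span_base) simp
    qed
    have "comb B' x' n a b \<in> fs.span (w' ` (A' <+> M'))"
      unfolding comb_def by (intro fs.span_add fs.span_sum) (simp_all add: * fs.span_scale[OF span_M])
    then show ?thesis using p ab by (simp add: w_def)
  next
    fix p assume p: "p \<in> M" "i = Inr p"
    then have pn: "p \<in> copies (B (Suc n))" unfolding M_def by auto
    obtain a b where ab: "x (Suc n) p = comb B' x' (Suc n) a b"
      using realizes_span[OF x' realizes_in[OF x pn]] by blast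
    have "w i = comb B' x' n (\<lambda>_. 0) a" using p by (simp add: w_def ab D_comb)
    also have "\<dots> = (\<Sum>q\<in>copies (B' (Suc n)). fun_scale (a q) (D (Suc n) (x' (Suc n) q)))"
      unfolding comb_def fs.scale_zero_left by (simp)
    also have "\<dots> \<in> fs.span (w' ` (A' <+> M'))"
      using span_M by (intro fs.span_sum fs.span_scale)
    finally show ?thesis .
  qed
  then have "card (A <+> M) \<le> card (A' <+> M')"
    using fs.card_le_if_independent_family[of "A <+> M" w "A' <+> M'" w'] ind fin by simp
  then show ?thesis unfolding A_def[symmetric] M_def[symmetric] A'_def[symmetric] M'_def[symmetric]
    using fin by (simp add: card_Plus)
qed

text \<open>With \<open>c\<close> constantly false, \<open>card_bars_le\<close> compares the numbers
  of nonzero boundaries; they agree and cancel from the counts of bars below \<open>(s, t)\<close>,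
  and such counts determine the multiset.\<close>

lemma realizes_unique:
  assumes B: "tagged_bars B" and x: "realizes B x" and B': "tagged_bars B'" and x': "realizes B' x'"
  shows "B = B'"
proof
  fix n
  let ?M = "\<lambda>B. card {p \<in> copies (B (Suc n)). 0 < fst (fst p)}"
  have "?M B \<le> ?M B'" using card_bars_le[OF B x B' x', where c = "\<lambda>_. False" and n = n] by simp
  moreover have "?M B' \<le> ?M B" using card_bars_le[OF B' x' B x, where c = "\<lambda>_. False" and n = n] by simp
  ultimately have M: "?M B = ?M B'" by simp
  show "B n = B' n"
  proof (rule multiset_eq_if_lower_sizes_eq)
    fix s t :: ereal
    let ?c = "\<lambda>I::tagged_interval. fst I \<le> s \<and> snd I \<le> t"
    have "card {p \<in> copies (B n). ?c (fst p)} + ?M B \<le> card {p \<in> copies (B' n). ?c (fst p)} + ?M B'"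
      by (rule card_bars_le[OF B x B' x', where c = ?c]) (auto intro: order_trans)
    moreover have "card {p \<in> copies (B' n). ?c (fst p)} + ?M B' \<le> card {p \<in> copies (B n). ?c (fst p)} + ?M B"
      by (rule card_bars_le[OF B' x' B x, where c = ?c]) (auto intro: order_trans)
    ultimately show "size (filter_mset ?c (B n)) = size (filter_mset ?c (B' n))"
      unfolding card_copies_filter[symmetric] M by simp
  qed
qed

text \<open>Each bar of degree \<open>n\<close> has a nonzero generator in degree \<open>n\<close>
  of \<open>X^0\<close>, and \<open>X^0\<close> is nonzero in finitely many degrees only.\<close>

lemma finite_degrees:
  assumes B: "tagged_bars B" and x: "realizes B x"
  shows "finite {n. B n \<noteq> {#}}"
proof (rule finite_subset)
  show "{n. B n \<noteq> {#}} \<subseteq> {n. carrier (Sp 0 n) \<noteq> {\<zero>\<^bsub>Sp 0 n\<^esub>}}"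
  proof
    fix n assume "n \<in> {n. B n \<noteq> {#}}"
    then obtain I where "I \<in># B n" by auto
    then have p: "(I, 0) \<in> copies (B n)" unfolding copies_def by simp
    have "E n (x n (I, 0)) \<noteq> \<zero>\<^bsub>Sp 0 n\<^esub>"
    proof
      assume "E n (x n (I, 0)) = \<zero>\<^bsub>Sp 0 n\<^esub>"
      then have "comb B x n (\<lambda>q. if q = (I, 0) then 1 else 0) (\<lambda>_. 0) = 0"
        unfolding comb_single[where B = B and x = x, OF p] using E_cong[OF realizes_in[OF x p], of 0] fs.subspace_0[OF U_subspace] E_zero
        by simp
      from realizes_vanish(1)[OF B x this p] show False by simp
    qed
    then show "n \<in> {n. carrier (Sp 0 n) \<noteq> {\<zero>\<^bsub>Sp 0 n\<^esub>}}" using E_closed by blast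
  qed
  show "finite {n. carrier (Sp 0 n) \<noteq> {\<zero>\<^bsub>Sp 0 n\<^esub>}}"
    using is_Ch[of 0] unfolding is_Ch_def by simp
qed

lemma tBar_unique_and_finite:
  "(\<exists>!tBar. is_tBar X tBar) \<and> (\<forall>tBar. is_tBar X tBar \<longrightarrow> finite {n. tBar n \<noteq> {#}})"
proof -
  obtain B x where Bx: "tagged_bars B" "realizes B x" by (fact realization_exists)
  have *: "B' = B \<and> finite {n. B' n \<noteq> {#}}" if B': "is_tBar X B'" for B'
  proof -
    from B' obtain x' where x': "realizes B' x'" by (rule realizes_if_is_tBar)
    have "tagged_bars B'" using B' by (simp add: is_tBar_alt)
    then show ?thesis using realizes_unique[OF _ x' Bx] finite_degrees[OF _ x'] by simp
  qed
  show ?thesis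
  proof (intro conjI ex1I allI impI)
    show "is_tBar X B" by (rule is_tBar_if_realizes[OF Bx])
    show "B' = B" if "is_tBar X B'" for B' using *[OF that] ..
    show "finite {n. B' n \<noteq> {#}}" if "is_tBar X B'" for B' using *[OF that] ..
  qed
qed

end

text \<open>A \<open>multiset\<close> is finite by its type, and uniqueness of the function
  \<open>tBar\<close> is uniqueness of all the multisets together. The second conjunct makes the
  whole direct sum finite.\<close>

theorem theorem2p17:
  fixes X :: "('k::field, 'v) param_complex"
  assumes "factored_chain_complex X"
  shows "(\<exists>!tBar. is_tBar X tBar) \<and>
         (\<forall>tBar. is_tBar X tBar \<longrightarrow> finite {n. tBar n \<noteq> {#}})"
  by (rule factored.tBar_unique_and_finite[OF factored.intro[OF assms]])

end
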